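(* Let $q=2^n$ with $n\ge3$ and $q\equiv1\pmod 3$, and let $\mathcal Q(4,q)$, $\mathcal Y$, $\mathcal L_0$, $\mathcal L_3$, $\mathcal Z_1,\mathcal Z_2,\mathcal Z_3$ be as defined in the context (the case $h=1$). Then every line of $\mathcal L_3$ has $3$ points in common with $\mathcal Y$, $\bigl(q-(-1)^{n/2}2\sqrt q-2\bigr)/3$ points in common with $\mathcal Z_1$, and $\bigl(q+(-1)^{n/2}\sqrt q-2\bigr)/3$ points in common with each of $\mathcal Z_2$ and $\mathcal Z_3$. Every line of $\mathcal L_0$ has $\bigl(q-(-1)^{n/2}2\sqrt q+1\bigr)/3$ points in common with $\mathcal Z_1$ and $\bigl(q+(-1)^{n/2}\sqrt q+1\bigr)/3$ points in common with each of $\mathcal Z_2$ and $\mathcal Z_3$.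
   Context: $\mathrm{PG}(5,q)$ has homogeneous coordinates $(X_1,\dots,X_6)$, written as column vectors when acted on by matrices; $U_i$ is the point with $1$ in position $i$ and $0$ elsewhere. $\Pi$ is the hyperplane $X_3+X_4=0$; $\mathcal Q^+(5,q):X_1X_6+X_2X_5+X_3X_4=0$; $\mathcal Q(4,q)=\mathcal Q^+(5,q)\cap\Pi$ is a parabolic quadric. $\tilde G_1\simeq\mathrm{PGL}(2,q)$ is the group of projectivities represented by the matrices, with $a,b,c,d\in\mathbb F_q$, $ad+bc=1$, $$\tilde M_{a,b,c,d}=\begin{pmatrix} a^{4}&0&a^{2}b^{2}&a^{2}b^{2}&0&b^{4}\\ 0&a^2&ab&ab&b^2&0\\ a^{2}c^{2}&ac&b^{2}c^{2}+bc+1&b^{2}c^{2}+bc&bd&b^{2}d^{2}\\ a^{2}c^{2}&ac&b^{2}c^{2}+bc&b^{2}c^{2}+bc+1&bd&b^{2}d^{2}\\ 0&c^2&cd&cd&d^2&0\\ c^{4}&0&c^{2}d^{2}&c^{2}d^{2}&0&d^{4}\end{pmatrix}.$$ $\mathcal Y$ is the set of points of $\Pi$ with $X_1X_5^{2}+X_2^{2}X_6=0$. For $i\in\{0,3\}$, $\mathcal L_i$ is the set of lines of $\mathcal Q(4,q)$ meeting $\mathcal Y$ in exactly $i$ points. Fix a primitive element $\omega$ of $\mathbb F_q$; for $i=1,2,3$, $\mathcal Z_i$ is the $\tilde G_1$-orbit of the point $R_i=U_1+\omega^{i-1}U_5$. Since $q\equiv1\pmod3$, $n$ is even. *)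

theory Defs
  imports "HOL-Analysis.Analysis"
begin

text \<open>
  Throughout, \<open>PG(5,q)\<close> is the lattice of subspaces of \<open>'a ^ 6\<close>, where \<open>'a\<close> is a finite field
  of order \<open>q\<close>: points and lines are the subspaces of dimension 1 and 2.  The homogeneous
  coordinates \<open>X\<^sub>1, \<dots>, X\<^sub>6\<close> are \<open>v $ 1, \<dots>, v $ 6\<close>; the index \<open>6 :: 6\<close> equals \<open>0 :: 6\<close>.
\<close>

type_synonym 'a subsp = "('a ^ 6) set"

definition pg_points :: "'a::field subsp set" where
  "pg_points = {P. vec.subspace P \<and> vec.dim P = 1}"

definition pg_lines :: "'a::field subsp set" where
  "pg_lines = {l. vec.subspace l \<and> vec.dim l = 2}"

definition points_on :: "'a::field subsp \<Rightarrow> 'a subsp set" where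
  "points_on l = {P \<in> pg_points. P \<subseteq> l}"

definition pg_point :: "'a::field ^ 6 \<Rightarrow> 'a subsp" where
  "pg_point v = vec.span {v}"

text \<open>The argument is meant to be a homogeneous form, so that its vanishing does not depend on
  the nonzero vector chosen to represent the point.\<close>

definition zero_locus :: "('a::field ^ 6 \<Rightarrow> 'a) \<Rightarrow> 'a subsp set" where
  "zero_locus f = {P \<in> pg_points. \<forall>v\<in>P. f v = 0}"

definition Pi_hyperplane :: "'a::field subsp set" where
  "Pi_hyperplane = zero_locus (\<lambda>v. v $ 3 + v $ 4)"

definition hyperbolic_quadric :: "'a::field subsp set" where
  "hyperbolic_quadric = zero_locus (\<lambda>v. v $ 1 * v $ 6 + v $ 2 * v $ 5 + v $ 3 * v $ 4)"

definition parabolic_quadric :: "'a::field subsp set" where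
  "parabolic_quadric = hyperbolic_quadric \<inter> Pi_hyperplane"

definition parabolic_quadric_lines :: "'a::field subsp set" where
  "parabolic_quadric_lines = {l \<in> pg_lines. points_on l \<subseteq> parabolic_quadric}"

definition M1 :: "'a::field \<Rightarrow> 'a \<Rightarrow> 'a \<Rightarrow> 'a \<Rightarrow> 'a ^ 6 ^ 6" where
  "M1 a b c d = vector
    [vector [a^4,     0,   a^2*b^2,           a^2*b^2,           0,   b^4],
     vector [0,       a^2, a*b,               a*b,               b^2, 0],
     vector [a^2*c^2, a*c, b^2*c^2 + b*c + 1, b^2*c^2 + b*c,     b*d, b^2*d^2],
     vector [a^2*c^2, a*c, b^2*c^2 + b*c,     b^2*c^2 + b*c + 1, b*d, b^2*d^2],
     vector [0,       c^2, c*d,               c*d,               d^2, 0],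
     vector [c^4,     0,   c^2*d^2,           c^2*d^2,           0,   d^4]]"

definition projectivity :: "'a::field ^ 6 ^ 6 \<Rightarrow> 'a subsp \<Rightarrow> 'a subsp" where
  "projectivity A P = (\<lambda>v. A *v v) ` P"

definition G1 :: "('a::field subsp \<Rightarrow> 'a subsp) set" where
  "G1 = {projectivity (M1 a b c d) | a b c d. a * d + b * c = 1}"

definition G1_orbit :: "'a::field subsp \<Rightarrow> 'a subsp set" where
  "G1_orbit P = {g P | g. g \<in> G1}"

definition Y_set :: "'a::field subsp set" where
  "Y_set = Pi_hyperplane \<inter> zero_locus (\<lambda>v. v $ 1 * (v $ 5)^2 + (v $ 2)^2 * v $ 6)"

definition L_lines :: "nat \<Rightarrow> 'a::field subsp set" where
  "L_lines i = {l \<in> parabolic_quadric_lines.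
     finite (points_on l \<inter> Y_set) \<and> card (points_on l \<inter> Y_set) = i}"

definition primitive_element :: "'a::field \<Rightarrow> bool" where
  "primitive_element \<omega> \<longleftrightarrow> range (\<lambda>k::nat. \<omega> ^ k) = UNIV - {0}"

definition R_point :: "'a::field \<Rightarrow> nat \<Rightarrow> 'a subsp" where
  "R_point \<omega> i = pg_point (axis 1 1 + \<omega> ^ (i - 1) *s axis 5 1)"

definition Z_set :: "'a::field \<Rightarrow> nat \<Rightarrow> 'a subsp set" where
  "Z_set \<omega> i = G1_orbit (R_point \<omega> i)"

end

theory Submission
  imports Defs
begin

text \<open>
  Put \<open>F(v) = X\<^sub>1 X\<^sub>5\<^sup>2 + X\<^sub>2\<^sup>2 X\<^sub>6\<close>.  A point of the quadric off \<open>Y\<close> lies in \<open>Z\<^sub>i\<close> iff it has a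
  representative with \<open>F = \<omega>\<^bsup>2(i - 1)\<^esup>\<close>, so one has to count the vectors of a line \<open>l\<close> on which \<open>F\<close>,
  a binary cubic form there, takes a given nonzero value \<open>c\<close>.  With \<open>\<psi>\<close> the canonical additive
  character, \<open>x \<mapsto> \<psi>(b F(x))\<close> is quadratic over \<open>GF(2)\<close>, since the monomials \<open>s\<^sup>3\<close> and \<open>s\<^sup>2t\<close> are;
  hence \<open>T(b) = \<Sum>\<^sub>x \<psi>(b F(x))\<close> satisfies \<open>T(b)\<^sup>2 = q\<^sup>2 |Rad\<^sub>b|\<close>, and its sign follows from
  \<open>T(b) \<equiv> 1 (mod 3)\<close>.  The one-variable sums \<open>\<Sum>\<^sub>y \<psi>(c y\<^sup>3)\<close> are evaluated in the same way.
  Isotropy of \<open>l\<close> makes the discriminant of \<open>F\<close> on \<open>l\<close> the square of a cube; this decides which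
  class of \<open>b\<close> modulo cubes is exceptional: \<open>T(b)\<close> is \<open>4q\<close> for cubes and \<open>q\<close> otherwise when
  \<open>F\<close> has three zeros, and \<open>q\<close> for cubes and \<open>-2q\<close> otherwise when it has none.
\<close>

section \<open>Quadratic Gauss sums in characteristic two\<close>

lemma card_eq_mult_card_image:
  assumes "finite A" "\<And>x. x \<in> A \<Longrightarrow> card {y \<in> A. f y = f x} = k"
  shows "card A = k * card (f ` A)"
proof -
  have "card A = (\<Sum>z\<in>f ` A. \<Sum>y\<in>{y \<in> A. f y = z}. 1)"
    using sum.image_gen[OF assms(1), of "\<lambda>_. 1::nat" f] by simp
  also have "\<dots> = (\<Sum>z\<in>f ` A. k)"
    using assms(2) by (intro sum.cong) auto
  finally show ?thesis by simp
qed

text \<open>The square is a double sum over \<open>u\<close> and \<open>w = u + v\<close>. For fixed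
  \<open>v\<close> the polarization \<open>g (u + v) * g u * g v\<close> is a sign-valued character
  in \<open>u\<close> by \<open>bichar\<close>, so orthogonality leaves only
  \<open>v \<in> R\<close>, each contributing \<open>g v = 1\<close> times
  \<open>card V\<close>.\<close>

lemma quadratic_gauss_sum_square:
  fixes g :: "'v::ab_group_add \<Rightarrow> int"
  assumes fin: "finite V" and ne: "V \<noteq> {}"
    and add: "\<And>u v. u \<in> V \<Longrightarrow> v \<in> V \<Longrightarrow> u + v \<in> V"
    and two: "\<And>u. u \<in> V \<Longrightarrow> u + u = 0"
    and sq: "\<And>u. g u * g u = 1"
    and bichar: "\<And>u u' v. u \<in> V \<Longrightarrow> u' \<in> V \<Longrightarrow> v \<in> V \<Longrightarrow>
      g (u + u' + v) * g (u + u') * g v =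
        (g (u + v) * g u * g v) * (g (u' + v) * g u' * g v)"
    and R: "R = {v \<in> V. \<forall>u\<in>V. g (u + v) * g u * g v = 1}"
    and one: "\<And>v. v \<in> R \<Longrightarrow> g v = 1"
  shows "(\<Sum>v\<in>V. g v)^2 = int (card V) * int (card R)"
proof -
  have bij: "bij_betw (\<lambda>v. u + v) V V" if "u \<in> V" for u
  proof (rule bij_betwI[where g = "\<lambda>v. u + v"])
    show "(+) u \<in> V \<rightarrow> V" "(+) u \<in> V \<rightarrow> V" using that add by auto
    show "u + (u + v) = v" "u + (u + v) = v" for v
      using two[OF that] by (metis add.assoc add_0)+
  qed
  have inner: "(\<Sum>u\<in>V. g (u + v) * g u * g v) = (if v \<in> R then int (card V) else 0)"
    (is "?S = _") if v: "v \<in> V" for v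
  proof (cases "v \<in> R")
    case True
    then show ?thesis unfolding R by simp
  next
    case False
    then obtain u0 where u0: "u0 \<in> V" "g (u0 + v) * g u0 * g v \<noteq> 1"
      using v unfolding R by auto
    define c where "c = g (u0 + v) * g u0 * g v"
    \<comment> \<open>Translation by \<open>u0\<close> multiplies the sum by
      \<open>c \<noteq> 1\<close>, so the sum vanishes.\<close>
    have "?S = (\<Sum>u\<in>V. g (u0 + u + v) * g (u0 + u) * g v)"
      by (rule sum.reindex_bij_betw[OF bij[OF u0(1)], symmetric])
    also have "\<dots> = (\<Sum>u\<in>V. c * (g (u + v) * g u * g v))"
      unfolding c_def by (rule sum.cong[OF refl], rule bichar[OF u0(1) _ v])
    also have "\<dots> = c * ?S" by (simp add: sum_distrib_left)
    finally have "(c - 1) * ?S = 0" by (simp add: algebra_simps)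
    then show ?thesis using u0(2) False unfolding c_def by simp
  qed
  have "(\<Sum>v\<in>V. g v)^2 = (\<Sum>u\<in>V. g u * (\<Sum>w\<in>V. g w))"
    by (simp add: power2_eq_square sum_distrib_right)
  also have "\<dots> = (\<Sum>u\<in>V. g u * (\<Sum>v\<in>V. g (u + v)))"
    by (intro sum.cong refl arg_cong2[where f = "(*)"] sum.reindex_bij_betw[OF bij, symmetric])
  also have "\<dots> = (\<Sum>u\<in>V. \<Sum>v\<in>V. g v * (g (u + v) * g u * g v))"
    unfolding sum_distrib_left using sq by (intro sum.cong refl) (simp add: ac_simps)
  also have "\<dots> = (\<Sum>v\<in>V. g v * (\<Sum>u\<in>V. g (u + v) * g u * g v))"
    by (subst sum.swap) (simp add: sum_distrib_left)
  also have "\<dots> = (\<Sum>v\<in>V. if v \<in> R then int (card V) else 0)"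
    using one by (intro sum.cong refl) (auto simp: inner)
  also have "\<dots> = int (card V) * int (card R)"
  proof -
    have "V \<inter> {v. v \<in> R} = R" unfolding R by auto
    then show ?thesis using fin by (simp add: sum.If_cases)
  qed
  finally show ?thesis .
qed

text \<open>The primitive cube root of unity \<open>\<zeta>\<close> is what \<open>q \<equiv> 1 (mod 3)\<close> provides.\<close>

locale char2_cubic_field =
  fixes \<zeta> :: "'a::{field,finite}" and m :: nat
  assumes two0: "(2::'a) = 0" and zeta: "\<zeta>^2 + \<zeta> + 1 = 0" and card_field: "CARD('a) = 2 ^ (2 * m)"
begin

section \<open>Arithmetic and the additive character in characteristic two\<close>

lemma add_self: "(x::'a) + x = 0"
  using two0 by (metis mult_2 mult_zero_left)

lemma add_self_left: "(x::'a) + (x + y) = y"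
  using add_self[of x] by (simp flip: add.assoc)

lemma minus_eq: "- (x::'a) = x"
  using add_self by (simp add: minus_unique)

lemma diff_eq: "(x::'a) - y = x + y"
  by (simp add: minus_eq diff_conv_add_uminus del: add_uminus_conv_diff)

lemma numeral_even: "(numeral (num.Bit0 k) :: 'a) = 0"
  by (simp only: numeral.simps add_self)

lemma numeral_odd: "(numeral (num.Bit1 k) :: 'a) = 1"
  by (simp only: numeral.simps add_self add_0)

text \<open>A normalizer for polynomial identities: products and powers are expanded into sorted
  monomials, and equal monomials cancel in pairs.\<close>

lemmas ring_char2 = add_self add_self_left minus_eq diff_eq numeral_even numeral_odd
  distrib_left distrib_right ac_simps eval_nat_numeral

lemma add_eq_0: "(x::'a) + y = 0 \<longleftrightarrow> x = y"
  by (metis add_self_left add_self add_0_right)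

lemma square_add: "((x::'a) + y)^2 = x^2 + y^2"
  by (simp add: ring_char2)

lemma square_eq: "(x::'a)^2 = y^2 \<longleftrightarrow> x = y"
  by (metis add_eq_0 square_add power_eq_0_iff zero_neq_numeral zero_power2)

lemma bij_square: "bij (\<lambda>x::'a. x^2)"
  by (simp add: bij_def inj_def square_eq finite_UNIV_inj_surj)

text \<open>\<open>{w\<^sup>2 + w}\<close> is the kernel of the absolute trace, so this is \<open>(-1)\<^bsup>Tr x\<^esup>\<close>.\<close>

definition psi :: "'a \<Rightarrow> int" where
  "psi x = (if \<exists>w. x = w^2 + w then 1 else -1)"

lemma psi_sq: "psi x * psi x = 1"
  by (simp add: psi_def)

lemma psi_cases: "psi x = 1 \<or> psi x = -1"
  by (simp add: psi_def)

text \<open>The root \<open>\<zeta>\<close> makes the trace of 1 vanish. Radical vectors turn out to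
  have scaled form values 0 or 1, so the summand is 1 on the radical.\<close>

lemma psi_1: "psi 1 = 1"
proof -
  have "1 = \<zeta>^2 + \<zeta>" using zeta add_eq_0[of "\<zeta>^2 + \<zeta>" 1] by simp
  then show ?thesis unfolding psi_def by auto
qed

lemma psi_0: "psi 0 = 1"
  unfolding psi_def using exI[of "\<lambda>w. (0::'a) = w^2 + w" 0] by simp

text \<open>The map is additive with kernel \<open>{0, 1}\<close>, so its image has index
  two.\<close>

lemma card_artin_schreier: "2 * card (range (\<lambda>w::'a. w^2 + w)) = CARD('a)"
proof -
  have "card {y \<in> UNIV. y^2 + y = x^2 + x} = 2" for x :: 'a
  proof -
    have "{y \<in> UNIV. y^2 + y = x^2 + x} = {x, x + 1}"
    proof -
      have "y^2 + y = x^2 + x \<longleftrightarrow> y = x \<or> y = x + 1" for y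
      proof -
        have "(y^2 + y) + (x^2 + x) = (y + x) * (y + (x + 1))"
          by (simp add: ring_char2)
        then show ?thesis using add_eq_0 by (metis mult_eq_0_iff)
      qed
      then show ?thesis by auto
    qed
    then show ?thesis by simp
  qed
  then show ?thesis
    using card_eq_mult_card_image[of "UNIV::'a set" "\<lambda>w. w^2 + w" 2] by simp
qed

text \<open>The image of \<open>w^2 + w\<close> is a subgroup; by counting, it and one further coset
  fill the field, so two elements outside it have their sum inside.\<close>

lemma psi_add: "psi (x + y) = psi x * psi y"
proof -
  let ?I = "range (\<lambda>w::'a. w^2 + w)"
  have psi: "psi x = (if x \<in> ?I then 1 else -1)" for x
    by (auto simp: psi_def)
  have I_add: "x + y \<in> ?I" if xy: "x \<in> ?I" "y \<in> ?I" for x y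
  proof -
    obtain v w where "x = v^2 + v" "y = w^2 + w" using xy by blast
    then have "x + y = (v + w)^2 + (v + w)" by (simp add: square_add ac_simps)
    then show ?thesis by blast
  qed
  have cancel: "x + (x + y) = y" for x y :: 'a
    by (rule add_self_left)
  have coset: "x + y \<in> ?I" if x: "x \<notin> ?I" and y: "y \<notin> ?I"
  proof -
    have inj: "inj_on ((+) x) ?I" by simp
    have disj: "?I \<inter> (+) x ` ?I = {}"
      using I_add x by (auto) (metis (no_types, lifting) cancel add.commute rangeI)
    have "card (?I \<union> (+) x ` ?I) = CARD('a)"
      using disj card_artin_schreier by (simp add: card_Un_disjoint card_image)
    then have "?I \<union> (+) x ` ?I = UNIV" by (simp add: card_eq_UNIV_imp_eq_UNIV)
    then have "y \<in> (+) x ` ?I" using y by blast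
    then show ?thesis using cancel by force
  qed
  show ?thesis
    using I_add[of x y] coset I_add[of x "x + y"] I_add[of y "x + y"] cancel[of x y] cancel[of y x]
    unfolding psi by (auto simp: add.commute)
qed

lemma psi_square: "psi (x^2) = psi x"
proof -
  have "psi (x^2 + x) = 1" unfolding psi_def by auto
  then show ?thesis
    using psi_add[of "x^2" x] psi_cases[of x] psi_cases[of "x^2"] by auto
qed

text \<open>Orthogonality: the kernel is only half of the field, and for \<open>c \<noteq> 0\<close>
  translating by \<open>x0 / c\<close> with \<open>psi x0 = -1\<close> negates the sum.\<close>

lemma sum_psi: "(\<Sum>x\<in>UNIV. psi (c * x)) = (if c = 0 then int CARD('a) else 0)"
proof (cases "c = 0")
  case True
  then show ?thesis by (simp add: psi_0)
next
  case False
  have "card (range (\<lambda>w::'a. w^2 + w)) < CARD('a)"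
    using card_artin_schreier zero_less_card_finite[where 'a='a] by linarith
  then have "range (\<lambda>w::'a. w^2 + w) \<noteq> UNIV" by (metis less_irrefl)
  then obtain x0 where "x0 \<notin> range (\<lambda>w::'a. w^2 + w)" by blast
  then have x0: "psi x0 = -1" by (auto simp: psi_def)
  have "bij (\<lambda>x. x + x0 / c)" by (rule bij_plus_right)
  then have "(\<Sum>x\<in>UNIV. psi (c * x)) = (\<Sum>x\<in>UNIV. psi (c * (x + x0 / c)))"
    by (rule sum.reindex_bij_betw[symmetric])
  also have "\<dots> = (\<Sum>x\<in>UNIV. psi (c * x) * psi x0)"
    using False by (intro sum.cong refl) (simp add: algebra_simps psi_add)
  also have "\<dots> = - (\<Sum>x\<in>UNIV. psi (c * x))"
    by (simp add: x0 sum_negf)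
  finally show ?thesis using False by simp
qed

text \<open>Frobenius invariance replaces \<open>d * s\<close> by \<open>d^2 * s^2\<close>; since
  \<open>s^2\<close> takes every value, orthogonality forces \<open>c + d^2 = 0\<close>. This turns
  radical conditions into polynomial equations.\<close>

lemma psi_linearized: "(\<forall>s. psi (c * s^2 + d * s) = 1) \<longleftrightarrow> c = d^2"
proof -
  have eq: "psi (c * s^2 + d * s) = psi ((c + d^2) * s^2)" for s
    using psi_square[of "d * s"] by (simp add: psi_add distrib_right power_mult_distrib)
  show ?thesis
  proof
    assume *: "\<forall>s. psi (c * s^2 + d * s) = 1"
    have "psi ((c + d^2) * x) = 1" for x
    proof -
      obtain s where "x = s^2" using bij_square by (metis bij_pointE)
      then show ?thesis using * eq by metis
    qed
    then have "c + d^2 = 0"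
      using sum_psi[of "c + d^2"] by (auto split: if_splits)
    then show "c = d^2" by (simp add: add_eq_0)
  next
    assume "c = d^2"
    then show "\<forall>s. psi (c * s^2 + d * s) = 1" using eq add_self psi_0 by simp
  qed
qed

section \<open>Cubes and one-variable cubic sums\<close>

definition cubes :: "'a set" where
  "cubes = (\<lambda>y. y^3) ` (UNIV - {0})"

lemma cubes_iff: "x \<in> cubes \<longleftrightarrow> x \<noteq> 0 \<and> (\<exists>y. x = y^3)"
  by (auto simp: cubes_def)

text \<open>\<open>y^3 + x^3\<close> splits into three distinct linear factors by means of
  \<open>\<zeta>\<close>.\<close>

lemma card_cube_roots: "card {y::'a. y^3 = x^3} = 3" if "x \<noteq> 0"
proof -
  have zeta1: "\<zeta> \<noteq> 1" "\<zeta> \<noteq> 0"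
    using zeta add_self[of 1] by auto
  then have zeta2: "\<zeta>^2 \<noteq> 1" "\<zeta>^2 \<noteq> \<zeta>"
    using square_eq[of \<zeta> 1] by (auto simp: power2_eq_square)
  have "y^3 = x^3 \<longleftrightarrow> y = x \<or> y = \<zeta> * x \<or> y = \<zeta>^2 * x" for y
  proof -
    have z: "\<zeta>^2 = \<zeta> + 1"
      using zeta add_eq_0[of "\<zeta>^2" "\<zeta> + 1"] by (simp add: add.assoc)
    have z': "\<zeta> * \<zeta> = \<zeta> + 1" "\<zeta> * (\<zeta> * a) = \<zeta> * a + a" for a
      using z by (simp_all add: power2_eq_square distrib_right flip: mult.assoc)
    have "y^3 + x^3 = (y + x) * (y + \<zeta> * x) * (y + \<zeta>^2 * x)"
      unfolding z by (simp add: ring_char2 z')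
    then show ?thesis using add_eq_0 by (metis mult_eq_0_iff)
  qed
  then have "{y. y^3 = x^3} = {x, \<zeta> * x, \<zeta>^2 * x}" by auto
  moreover have "x \<noteq> \<zeta> * x" "x \<noteq> \<zeta>^2 * x" "\<zeta> * x \<noteq> \<zeta>^2 * x"
    using zeta1 zeta2 that by auto
  ultimately show ?thesis by simp
qed

lemma sum_cubes: "(\<Sum>y\<in>UNIV - {0}. h (y^3)) = 3 * (\<Sum>b\<in>cubes. h b)" for h :: "'a \<Rightarrow> int"
proof -
  have "(\<Sum>y\<in>UNIV - {0}. h (y^3)) = (\<Sum>b\<in>cubes. \<Sum>y\<in>{y \<in> UNIV - {0}. y^3 = b}. h (y^3))"
    unfolding cubes_def by (rule sum.image_gen) simp
  also have "\<dots> = (\<Sum>b\<in>cubes. 3 * h b)"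
  proof (rule sum.cong[OF refl])
    fix b assume "b \<in> cubes"
    then obtain x where x: "x \<noteq> 0" "b = x^3" by (auto simp: cubes_def)
    then have "{y \<in> UNIV - {0}. y^3 = b} = {y. y^3 = x^3}" by auto
    then show "(\<Sum>y\<in>{y \<in> UNIV - {0}. y^3 = b}. h (y^3)) = 3 * h b"
      using card_cube_roots[OF x(1)] x(2) by simp
  qed
  finally show ?thesis by (simp add: sum_distrib_left)
qed

lemma card_cubes: "3 * card cubes = CARD('a) - 1"
  using sum_cubes[of "\<lambda>_. 1"] by (simp add: card_Diff_singleton)

definition cubic_sum :: "'a \<Rightarrow> int" where
  "cubic_sum c = (\<Sum>y\<in>UNIV. psi (c * y^3))"

text \<open>The term \<open>y = 0\<close> gives 1 and every nonzero cube is hit three times. The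
  residue 1 modulo 3 later fixes the sign of the sum.\<close>

lemma cubic_sum_cubes: "cubic_sum c = 1 + 3 * (\<Sum>b\<in>cubes. psi (c * b))"
proof -
  have "cubic_sum c = psi (c * 0^3) + (\<Sum>y\<in>UNIV - {0}. psi (c * y^3))"
    unfolding cubic_sum_def by (rule sum.remove) auto
  then show ?thesis using sum_cubes[of "\<lambda>b. psi (c * b)"] by (simp add: psi_0)
qed

lemma eq_of_square_eq_mod_3:
  fixes S t :: int
  assumes "S^2 = t^2" "S mod 3 = 1" "t mod 3 = 1"
  shows "S = t"
proof -
  have "S = t \<or> S = - t" using assms(1) by (simp add: power2_eq_iff)
  then show ?thesis using assms(2,3) by presburger
qed

lemma mod_3_power: "(-2::int)^k mod 3 = 1"
proof (induction k)
  case (Suc k)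
  then show ?case unfolding power_Suc by presburger
qed simp

text \<open>The equation factors as \<open>y = 0\<close> or \<open>c * y^3 = 1\<close>, the latter
  being solvable exactly for cubes \<open>c\<close>. Besides describing the radical of
  \<open>psi (c * y^3)\<close>, it is reused for radicals on lines.\<close>

lemma cubic_radical:
  assumes "c \<noteq> 0"
  shows "card {y::'a. c * y = (c * y^2)^2} = (if c \<in> cubes then 4 else 1)"
proof -
  have iff: "c * y = (c * y^2)^2 \<longleftrightarrow> y = 0 \<or> c * y^3 = 1" for y
    using assms by algebra
  show ?thesis
  proof (cases "c \<in> cubes")
    case True
    then obtain x where x: "x \<noteq> 0" "c = x^3" by (auto simp: cubes_def)
    then have "{y. c * y = (c * y^2)^2} = insert 0 {y. y^3 = (1/x)^3}"
      unfolding iff by (auto simp: field_simps)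
    moreover have "0 \<notin> {y. y^3 = (1/x)^3}" using x by auto
    ultimately show ?thesis
      using card_cube_roots[of "1/x"] x True by simp
  next
    case False
    have "c * y^3 \<noteq> 1" for y
    proof
      assume "c * y^3 = 1"
      then have "c = (1/y)^3" "c \<noteq> 0"
        by (auto simp: power_one_over eq_divide_eq)
      with False show False by (auto simp: cubes_iff)
    qed
    then have "{y. c * y = (c * y^2)^2} = {0}" unfolding iff by auto
    then show ?thesis using False by simp
  qed
qed

text \<open>The square is \<open>CARD('a)\<close> times the size of the radical, 4 or 1. Since
  \<open>-2\<close> is 1 modulo 3, the powers of \<open>-2\<close> are the square roots with the
  right sign.\<close>

lemma cubic_sum_eq:
  assumes "c \<noteq> 0"
  shows "cubic_sum c = (if c \<in> cubes then (-2)^(m+1) else (-2)^m)"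
proof -
  have beta: "psi (c * (u + v)^3) * psi (c * u^3) * psi (c * v^3) = psi (c * v * u^2 + c * v^2 * u)" for u v
  proof -
    have "c * (u + v)^3 + c * u^3 + c * v^3 = c * v * u^2 + c * v^2 * u"
      by (simp add: ring_char2)
    then show ?thesis by (simp flip: psi_add)
  qed
  have rad: "{v \<in> UNIV. \<forall>u\<in>UNIV. psi (c * (u + v)^3) * psi (c * u^3) * psi (c * v^3) = 1} =
      {v. c * v = (c * v^2)^2}"
    unfolding beta using psi_linearized[of "c * v" "c * v^2" for v] by simp
  have "(\<Sum>v\<in>UNIV. psi (c * v^3))^2 = int CARD('a) * int (card {v. c * v = (c * v^2)^2})"
  proof (rule quadratic_gauss_sum_square[OF _ _ _ _ _ _ rad[symmetric]])
    show "psi (c * v^3) = 1" if "v \<in> {v. c * v = (c * v^2)^2}" for v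
    proof -
      have "c * v^3 = 0 \<or> c * v^3 = 1" using that assms by algebra
      then show ?thesis using psi_0 psi_1 by auto
    qed
    show "psi (c * (u + u' + v)^3) * psi (c * (u + u')^3) * psi (c * v^3) =
      psi (c * (u + v)^3) * psi (c * u^3) * psi (c * v^3) *
      (psi (c * (u' + v)^3) * psi (c * u'^3) * psi (c * v^3))" for u u' v
    proof -
      have "c * v * (u + u')^2 + c * v^2 * (u + u') =
        (c * v * u^2 + c * v^2 * u) + (c * v * u'^2 + c * v^2 * u')"
        by (simp add: square_add algebra_simps)
      then show ?thesis by (simp only: beta psi_add)
    qed
  qed (auto simp: add_self psi_sq)
  then have "(cubic_sum c)^2 = (if c \<in> cubes then (-2)^(m+1) else (-2)^m)^2"
    unfolding cubic_sum_def cubic_radical[OF assms]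
    by (simp add: card_field power_mult power2_eq_square flip: power_mult_distrib)
  moreover have "cubic_sum c mod 3 = 1" unfolding cubic_sum_cubes by simp
  moreover have "(if c \<in> cubes then (-2)^(m+1) else (-2)^m :: int) mod 3 = 1"
    by (simp only: mod_3_power split: if_split) simp
  ultimately show ?thesis by (rule eq_of_square_eq_mod_3)
qed

end

section \<open>The binary cubic form on a totally isotropic line\<close>

text \<open>The coefficients of \<open>s\<^sup>2t\<close> and \<open>st\<^sup>2\<close> in \<open>F(s u + t v)\<close> are \<open>cubic_mix u v\<close> and \<open>cubic_mix v u\<close>.\<close>

definition cubic_mix :: "'a::field ^ 6 \<Rightarrow> 'a ^ 6 \<Rightarrow> 'a" where
  "cubic_mix u v = v $ 1 * (u $ 5)^2 + (u $ 2)^2 * v $ 6"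

abbreviation cubic_form :: "'a::field ^ 6 \<Rightarrow> 'a" where
  "cubic_form v \<equiv> cubic_mix v v"

text \<open>Encoding a basis as a bijection from coordinate pairs lets sums and cardinalities over
  the line be reindexed directly.\<close>

definition line_basis :: "'a::field subsp \<Rightarrow> 'a ^ 6 \<Rightarrow> 'a ^ 6 \<Rightarrow> bool" where
  "line_basis l u v \<longleftrightarrow> bij_betw (\<lambda>(s, t). s *s u + t *s v) UNIV l"

lemma line_basisI:
  assumes l: "l \<in> pg_lines" and u: "u \<in> l" "u \<noteq> 0" and v: "v \<in> l" "v \<notin> vec.span {u}"
  shows "line_basis l u v"
proof -
  have sub: "vec.subspace l" and dim: "vec.dim l = 2" using l by (auto simp: pg_lines_def)
  have ind: "vec.independent {v, u}"
    using u v by (auto simp: vec.independent_insert)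
  have ne: "u \<noteq> v" using v vec.span_base[of u "{u}"] by auto
  have "l \<subseteq> vec.span {v, u}"
    using ne by (intro vec.card_ge_dim_independent[OF _ ind]) (auto simp: u v dim)
  moreover have "w \<in> (\<lambda>(s, t). s *s u + t *s v) ` UNIV" if "w \<in> vec.span {v, u}" for w
  proof -
    obtain t where "w - t *s v \<in> vec.span {u}"
      using \<open>w \<in> vec.span {v, u}\<close> vec.span_breakdown_eq[of w v "{u}"] by auto
    then obtain s where "w - t *s v = s *s u"
      by (auto simp: vec.span_singleton)
    then have "w = s *s u + t *s v" by (simp add: algebra_simps)
    then show ?thesis by (auto intro!: image_eqI[of _ _ "(s, t)"])
  qed
  moreover have "s *s u + t *s v \<in> l" for s t
    using sub u v by (simp add: vec.subspace_add vec.subspace_scale)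
  ultimately have img: "(\<lambda>(s, t). s *s u + t *s v) ` UNIV = l" by auto
  have "inj (\<lambda>(s, t). s *s u + t *s v)"
  proof (rule injI, clarify)
    fix s t s' t' assume eq: "s *s u + t *s v = s' *s u + t' *s v"
    have t: "t = t'"
    proof (rule ccontr)
      assume "t \<noteq> t'"
      have "(t - t') *s v = (s' - s) *s u"
        using eq by (simp add: vec.scale_left_diff_distrib algebra_simps)
      then have "inverse (t - t') *s ((t - t') *s v) = inverse (t - t') *s ((s' - s) *s u)" by (simp only:)
      then have "v = (inverse (t - t') * (s' - s)) *s u"
        using \<open>t \<noteq> t'\<close> by (simp only: vec.scale_scale) simp
      then show False using v(2) by (metis vec.span_singleton rangeI)
    qed
    then have "s *s u = s' *s u" using eq by simp
    then show "s = s' \<and> t = t'" using t u(2) by simp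
  qed
  then show ?thesis using img by (simp add: line_basis_def bij_betw_def)
qed

lemma line_basis_extend:
  assumes l: "l \<in> pg_lines" and u: "u \<in> l" "u \<noteq> 0"
  obtains v where "v \<in> l" "line_basis l u v"
proof -
  have "\<not> l \<subseteq> vec.span {u}"
  proof
    assume "l \<subseteq> vec.span {u}"
    then have "vec.dim l \<le> card {u}" by (intro vec.dim_le_card) auto
    then show False using l by (simp add: pg_lines_def)
  qed
  then show ?thesis using that line_basisI[OF l u] by blast
qed

lemma line_basis_exists:
  assumes l: "l \<in> pg_lines"
  obtains u v where "line_basis l u v"
proof -
  have "\<not> l \<subseteq> {0}"
  proof
    assume "l \<subseteq> {0}"
    then have "vec.dim l = 0" using vec.dim_eq_0 by blast
    then show False using l unfolding pg_lines_def by (simp del: vec.dim_eq_0)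
  qed
  then obtain u where "u \<in> l" "u \<noteq> 0" by auto
  then show ?thesis using that line_basis_extend[OF l] by metis
qed

lemma line_basis_mem:
  assumes "line_basis l u v"
  shows "s *s u + t *s v \<in> l" "u \<in> l" "v \<in> l" "u \<noteq> 0" "v \<noteq> 0"
proof -
  have img: "l = range (\<lambda>(s, t). s *s u + t *s v)" and inj: "inj (\<lambda>(s, t). s *s u + t *s v)"
    using assms by (auto simp: line_basis_def bij_betw_def)
  show mem: "s *s u + t *s v \<in> l" for s t unfolding img by (rule image_eqI[of _ _ "(s, t)"]) auto
  show "u \<in> l" "v \<in> l" using mem[of 1 0] mem[of 0 1] by auto
  show "u \<noteq> 0" using injD[OF inj, of "(1, 0)" "(0, 0)"] by auto
  show "v \<noteq> 0" using injD[OF inj, of "(0, 1)" "(0, 0)"] by auto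
qed

lemma line_basis_cases:
  assumes "line_basis l u v" "w \<in> l"
  obtains s t where "w = s *s u + t *s v"
  using assms by (auto simp: line_basis_def bij_betw_def)

lemma cubic_form_scale: "cubic_form (s *s u) = s^3 * cubic_form u"
  by (simp add: cubic_mix_def algebra_simps power2_eq_square power3_eq_cube)

text \<open>A line of the parabolic quadric, with both equations imposed on vectors rather than
  points, as the exponential sums run over vectors.\<close>

locale isotropic_line = char2_cubic_field \<zeta> m for \<zeta> :: "'a::{field,finite}" and m +
  fixes l :: "'a subsp"
  assumes line: "l \<in> pg_lines"
    and quadric: "\<And>w. w \<in> l \<Longrightarrow> w $ 1 * w $ 6 + w $ 2 * w $ 5 + w $ 3 * w $ 4 = 0"
    and hyperplane: "\<And>w. w \<in> l \<Longrightarrow> w $ 3 + w $ 4 = 0"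
begin

lemma cubic_form_comb:
  "cubic_form (s *s u + t *s v) =
    cubic_form u * s^3 + cubic_mix u v * s^2 * t + cubic_mix v u * s * t^2 + cubic_form v * t^3"
    for u v :: "'a ^ 6"
  by (simp add: cubic_mix_def ring_char2)

text \<open>The left-hand side is the square root of the discriminant of the binary cubic form that
  \<open>cubic_form\<close> induces on the line; total isotropy of the line makes it a cube.\<close>

lemma discriminant_cube:
  assumes "u \<in> l" "v \<in> l"
  shows "\<exists>\<delta>. cubic_form u * cubic_form v + cubic_mix u v * cubic_mix v u = \<delta>^3"
proof -
  have q: "w $ 1 * w $ 6 + w $ 2 * w $ 5 = (w $ 3)^2" if "w \<in> l" for w
    using quadric[OF that] hyperplane[OF that] by (simp add: add_eq_0 power2_eq_square)
  have "u + v \<in> l" using assms line by (simp add: pg_lines_def vec.subspace_add)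
  from q[OF this] have "(u $ 1 * u $ 6 + u $ 2 * u $ 5) + (v $ 1 * v $ 6 + v $ 2 * v $ 5) +
      ((u $ 1 * v $ 6 + u $ 6 * v $ 1) + (u $ 2 * v $ 5 + u $ 5 * v $ 2)) = (u $ 3)^2 + (v $ 3)^2"
    by (simp add: square_add algebra_simps)
  \<comment> \<open>On the hyperplane \<open>X_3 X_4\<close> becomes the additive square
    \<open>X_3^2\<close>, so only the polar form of \<open>X_1 X_6 + X_2 X_5\<close> remains, and it
    vanishes.\<close>
  then have polar: "u $ 1 * v $ 6 + u $ 6 * v $ 1 = u $ 2 * v $ 5 + u $ 5 * v $ 2"
    using q[OF assms(1)] q[OF assms(2)] by (simp add: add_eq_0)
  have "cubic_form u * cubic_form v + cubic_mix u v * cubic_mix v u =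
      (u $ 1 * v $ 6 + u $ 6 * v $ 1) * (u $ 2 * v $ 5 + u $ 5 * v $ 2)^2"
    by (simp add: cubic_mix_def ring_char2)
  also have "\<dots> = (u $ 1 * v $ 6 + u $ 6 * v $ 1)^3"
    by (simp add: polar power2_eq_square power3_eq_cube)
  finally show ?thesis by blast
qed

section \<open>Exponential sums of the cubic form along the line\<close>

definition line_sum :: "'a \<Rightarrow> int" where
  "line_sum b = (\<Sum>w\<in>l. psi (b * cubic_form w))"

text \<open>The radical of the polar form over \<open>GF(2)\<close>, written multiplicatively to
  match \<open>quadratic_gauss_sum_square\<close>.\<close>

definition radical :: "'a \<Rightarrow> 'a subsp" where
  "radical b = {r \<in> l. \<forall>w\<in>l.
     psi (b * cubic_form (w + r)) * psi (b * cubic_form w) * psi (b * cubic_form r) = 1}"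

lemma card_line: "card l = CARD('a)^2"
proof -
  obtain u v where "line_basis l u v" using line_basis_exists[OF line] by blast
  then have "card l = card (UNIV :: ('a \<times> 'a) set)"
    unfolding line_basis_def by (metis bij_betw_same_card)
  then show ?thesis by (simp add: power2_eq_square flip: UNIV_Times_UNIV)
qed

text \<open>Every monomial of the form is a square times a linear factor, both additive, so after
  polarizing no product of \<open>s\<close> and \<open>t\<close> survives and the character splits
  into a factor in \<open>s\<close> and one in \<open>t\<close>.\<close>

lemma polar_psi:
  fixes s t x y b :: 'a and u v :: "'a ^ 6"
  defines "w \<equiv> s *s u + t *s v" and "r \<equiv> x *s u + y *s v"
  shows "psi (b * cubic_form (w + r)) * psi (b * cubic_form w) * psi (b * cubic_form r) =
    psi (b * (cubic_form u * x + cubic_mix u v * y) * s^2 +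
         b * (cubic_form u * x^2 + cubic_mix v u * y^2) * s) *
    psi (b * (cubic_mix v u * x + cubic_form v * y) * t^2 +
         b * (cubic_mix u v * x^2 + cubic_form v * y^2) * t)"
proof -
  have wr: "w + r = (s + x) *s u + (t + y) *s v"
    unfolding w_def r_def by (simp add: vec.scale_left_distrib ac_simps)
  show ?thesis
    unfolding wr unfolding w_def r_def cubic_form_comb psi_add[symmetric]
    by (rule arg_cong[of _ _ psi]) (simp add: ring_char2)
qed

lemma radical_iff:
  assumes "line_basis l u v"
  shows "x *s u + y *s v \<in> radical b \<longleftrightarrow>
    b * (cubic_form u * x + cubic_mix u v * y) = (b * (cubic_form u * x^2 + cubic_mix v u * y^2))^2 \<and>
    b * (cubic_mix v u * x + cubic_form v * y) = (b * (cubic_mix u v * x^2 + cubic_form v * y^2))^2"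
    (is "_ \<longleftrightarrow> ?c1 = ?d1^2 \<and> ?c2 = ?d2^2")
proof -
  have "x *s u + y *s v \<in> radical b \<longleftrightarrow>
    (\<forall>s t. psi (?c1 * s^2 + ?d1 * s) * psi (?c2 * t^2 + ?d2 * t) = 1)"
    unfolding radical_def polar_psi[symmetric]
    using line_basis_mem(1)[OF assms] line_basis_cases[OF assms] by (simp, metis)
  also have "\<dots> \<longleftrightarrow> (\<forall>s. psi (?c1 * s^2 + ?d1 * s) = 1) \<and> (\<forall>t. psi (?c2 * t^2 + ?d2 * t) = 1)"
  proof
    assume *: "\<forall>s t. psi (?c1 * s^2 + ?d1 * s) * psi (?c2 * t^2 + ?d2 * t) = 1"
    show "(\<forall>s. psi (?c1 * s^2 + ?d1 * s) = 1) \<and> (\<forall>t. psi (?c2 * t^2 + ?d2 * t) = 1)"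
      \<comment> \<open>Setting \<open>t = 0\<close> or \<open>s = 0\<close> makes the other factor
        \<open>psi 0 = 1\<close>.\<close>
      using *[rule_format, of _ 0] *[rule_format, of 0] by (simp add: psi_0)
  qed simp
  finally show ?thesis unfolding psi_linearized .
qed

text \<open>Writing the form as \<open>x^2 (A x + B y) + y^2 (C x + D y)\<close> and inserting the
  two radical equations shows that \<open>b * cubic_form r\<close> equals its own square.\<close>

lemma radical_value:
  assumes r: "r \<in> radical b"
  shows "b * cubic_form r = 0 \<or> b * cubic_form r = 1"
proof -
  obtain u v where uv: "line_basis l u v" using line_basis_exists[OF line] by blast
  obtain x y where xy: "r = x *s u + y *s v"
    using r line_basis_cases[OF uv] by (auto simp: radical_def)
  let ?A = "cubic_form u" and ?B = "cubic_mix u v" and ?C = "cubic_mix v u" and ?D = "cubic_form v"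
  have "b * cubic_form r = x^2 * (b * (?A * x + ?B * y)) + y^2 * (b * (?C * x + ?D * y))"
    unfolding xy cubic_form_comb by (simp add: ring_char2)
  also have "\<dots> = x^2 * (b * (?A * x^2 + ?C * y^2))^2 + y^2 * (b * (?B * x^2 + ?D * y^2))^2"
    using r unfolding xy radical_iff[OF uv] by simp
  also have "\<dots> = (b * cubic_form r)^2"
    unfolding xy cubic_form_comb by (simp add: square_add power_mult_distrib) (simp add: ring_char2)
  finally show ?thesis by (simp add: power2_eq_square)
qed

lemma line_sum_square: "(line_sum b)^2 = int (CARD('a)^2) * int (card (radical b))"
proof -
  obtain u v where uv: "line_basis l u v" using line_basis_exists[OF line] by blast
  show ?thesis
    unfolding line_sum_def card_line[symmetric]
  proof (rule quadratic_gauss_sum_square[OF _ _ _ _ _ _ radical_def])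
    show "l \<noteq> {}" using line_basis_mem[OF uv] by auto
    show "a + c \<in> l" if "a \<in> l" "c \<in> l" for a c
      using that line by (simp add: pg_lines_def vec.subspace_add)
    show "a + a = 0" for a :: "'a ^ 6" unfolding vec_eq_iff vector_add_component add_self by simp
    show "psi (b * cubic_form r) = 1" if "r \<in> radical b" for r
      using radical_value[OF that] psi_0 psi_1 by auto
    show "psi (b * cubic_form (p + p' + r)) * psi (b * cubic_form (p + p')) * psi (b * cubic_form r) =
      psi (b * cubic_form (p + r)) * psi (b * cubic_form p) * psi (b * cubic_form r) *
      (psi (b * cubic_form (p' + r)) * psi (b * cubic_form p') * psi (b * cubic_form r))"
      if "p \<in> l" "p' \<in> l" "r \<in> l" for p p' r
    proof -
      obtain s t where p: "p = s *s u + t *s v" using line_basis_cases[OF uv \<open>p \<in> l\<close>] .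
      obtain s' t' where p': "p' = s' *s u + t' *s v" using line_basis_cases[OF uv \<open>p' \<in> l\<close>] .
      obtain x y where r: "r = x *s u + y *s v" using line_basis_cases[OF uv \<open>r \<in> l\<close>] .
      have pp': "p + p' = (s + s') *s u + (t + t') *s v"
        unfolding p p' by (simp add: vec.scale_left_distrib ac_simps)
      have split: "psi (c * (s + s')^2 + d * (s + s')) = psi (c * s^2 + d * s) * psi (c * s'^2 + d * s')"
        for c d s s' by (simp add: square_add distrib_left psi_add ac_simps)
      show ?thesis
        unfolding pp' unfolding p p' r polar_psi split by (simp only: ac_simps)
    qed
  qed (auto simp: psi_sq)
qed

text \<open>Vectors with \<open>s \<noteq> 0\<close> are grouped by the slope
  \<open>a = t / s\<close>; by homogeneity each group is three times a sum over cubes. The axis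
  \<open>s = 0\<close> gives a cubic sum, which is 1 modulo 3.\<close>

lemma line_sum_mod_3: "line_sum b mod 3 = 1"
proof -
  obtain u v where uv: "line_basis l u v" using line_basis_exists[OF line] by blast
  define f where "f s t = psi (b * cubic_form (s *s u + t *s v))" for s t
  have "line_sum b = (\<Sum>(s, t)\<in>UNIV. f s t)"
    using sum.reindex_bij_betw[OF uv[unfolded line_basis_def], of "\<lambda>w. psi (b * cubic_form w)"]
    by (simp add: line_sum_def f_def case_prod_unfold)
  also have "\<dots> = (\<Sum>s\<in>UNIV. \<Sum>t\<in>UNIV. f s t)"
    by (simp add: sum.cartesian_product)
  also have "\<dots> = (\<Sum>t\<in>UNIV. f 0 t) + (\<Sum>s\<in>UNIV - {0}. \<Sum>t\<in>UNIV. f s t)"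
    by (rule sum.remove) auto
  also have "(\<Sum>t\<in>UNIV. f 0 t) = cubic_sum (b * cubic_form v)"
    by (simp add: f_def cubic_sum_def cubic_form_scale ac_simps)
  also have "(\<Sum>s\<in>UNIV - {0}. \<Sum>t\<in>UNIV. f s t) = (\<Sum>s\<in>UNIV - {0}. \<Sum>a\<in>UNIV. f s (s * a))"
  proof (rule sum.cong[OF refl])
    fix s :: 'a assume "s \<in> UNIV - {0}"
    then have "bij (\<lambda>a. s * a)" by (intro bij_betwI[where g = "\<lambda>a. a / s"]) auto
    then show "(\<Sum>t\<in>UNIV. f s t) = (\<Sum>a\<in>UNIV. f s (s * a))"
      by (rule sum.reindex_bij_betw[symmetric])
  qed
  also have "\<dots> = (\<Sum>a\<in>UNIV. \<Sum>s\<in>UNIV - {0}. f s (s * a))" by (rule sum.swap)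
  also have "\<dots> = (\<Sum>a\<in>UNIV. \<Sum>s\<in>UNIV - {0}. psi (b * cubic_form (u + a *s v) * s^3))"
  proof -
    have scale: "s *s u + (s * a) *s v = s *s (u + a *s v)" for s a
      by (simp add: vec.scale_right_distrib)
    show ?thesis unfolding f_def scale cubic_form_scale by (simp only: ac_simps)
  qed
  also have "\<dots> = 3 * (\<Sum>a\<in>UNIV. \<Sum>c\<in>cubes. psi (b * cubic_form (u + a *s v) * c))"
    by (simp add: sum_cubes[of "\<lambda>c. psi (d * c)" for d] sum_distrib_left)
  finally show ?thesis by (simp add: cubic_sum_cubes mod_add_eq)
qed

section \<open>From exponential sums to the number of vectors with a given form value\<close>

lemma line_sum_0: "line_sum 0 = int (CARD('a)^2)"
  by (simp add: line_sum_def psi_0 card_line)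

text \<open>Fourier inversion: summing over \<open>b\<close> first isolates the vectors with form
  value \<open>c\<close>, the sign of \<open>c\<close> being immaterial in characteristic
  two.\<close>

lemma sum_line_sum_psi:
  "(\<Sum>b\<in>UNIV. line_sum b * psi (c * b)) = int CARD('a) * int (card {w \<in> l. cubic_form w = c})"
proof -
  have "(\<Sum>b\<in>UNIV. line_sum b * psi (c * b)) = (\<Sum>b\<in>UNIV. \<Sum>w\<in>l. psi ((cubic_form w + c) * b))"
    by (simp add: line_sum_def sum_distrib_left sum_distrib_right distrib_left psi_add ac_simps)
  also have "\<dots> = (\<Sum>w\<in>l. \<Sum>b\<in>UNIV. psi ((cubic_form w + c) * b))" by (rule sum.swap)
  also have "\<dots> = (\<Sum>w\<in>l. if cubic_form w = c then int CARD('a) else 0)"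
    by (simp add: sum_psi add_eq_0)
  also have "\<dots> = int CARD('a) * int (card {w \<in> l. cubic_form w = c})"
    by (simp add: sum.If_cases Int_def)
  finally show ?thesis .
qed

text \<open>Split \<open>line_sum b\<close> for \<open>b \<noteq> 0\<close> as the constant
  \<open>\<beta>\<close> plus \<open>\<alpha> - \<beta>\<close> on cubes; the first part sums to
  \<open>-\<beta>\<close>, the second to a multiple of \<open>(cubic_sum c - 1) / 3\<close>. The
  factor 3 avoids this division.\<close>

lemma card_value:
  assumes sums: "\<And>b. b \<noteq> 0 \<Longrightarrow> line_sum b = (if b \<in> cubes then \<alpha> else \<beta>)" and c: "c \<noteq> 0"
  shows "3 * int CARD('a) * int (card {w \<in> l. cubic_form w = c}) =
    3 * int (CARD('a)^2) - 3 * \<beta> + (\<alpha> - \<beta>) * (cubic_sum c - 1)"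
proof -
  have "(\<Sum>b\<in>UNIV. psi (c * b)) = psi (c * 0) + (\<Sum>b\<in>UNIV - {0}. psi (c * b))"
    by (rule sum.remove) auto
  then have nz: "(\<Sum>b\<in>UNIV - {0}. psi (c * b)) = -1"
    using c by (simp add: sum_psi psi_0)
  have "int CARD('a) * int (card {w \<in> l. cubic_form w = c}) =
      line_sum 0 * psi (c * 0) + (\<Sum>b\<in>UNIV - {0}. line_sum b * psi (c * b))"
    unfolding sum_line_sum_psi[symmetric] by (rule sum.remove) auto
  also have "(\<Sum>b\<in>UNIV - {0}. line_sum b * psi (c * b)) =
      (\<Sum>b\<in>UNIV - {0}. \<beta> * psi (c * b) + (if b \<in> cubes then (\<alpha> - \<beta>) * psi (c * b) else 0))"
    by (intro sum.cong refl) (simp add: sums algebra_simps)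
  also have "\<dots> = \<beta> * (\<Sum>b\<in>UNIV - {0}. psi (c * b)) + (\<alpha> - \<beta>) * (\<Sum>b\<in>cubes. psi (c * b))"
  proof -
    have "(UNIV - {0}) \<inter> {b. b \<in> cubes} = cubes" by (auto simp: cubes_iff)
    then show ?thesis by (simp add: sum.distrib sum.If_cases sum_distrib_left)
  qed
  also have "\<dots> = - \<beta> + (\<alpha> - \<beta>) * (\<Sum>b\<in>cubes. psi (c * b))" by (simp add: nz)
  finally show ?thesis
    using cubic_sum_cubes[of c] by (simp add: line_sum_0 psi_0 algebra_simps)
qed

lemma card_field_mod_3: "int CARD('a) mod 3 = 1"
  using mod_3_power[of "2 * m"] by (simp add: card_field)

lemma line_sum_of_card_radical:
  assumes "int (card (radical b)) = k^2" "k mod 3 = 1"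
  shows "line_sum b = k * int CARD('a)"
proof (rule eq_of_square_eq_mod_3[OF _ line_sum_mod_3])
  show "(line_sum b)^2 = (k * int CARD('a))^2"
    unfolding line_sum_square assms(1) by (simp add: power_mult_distrib)
  show "k * int CARD('a) mod 3 = 1"
    using mod_mult_eq[of k 3 "int CARD('a)"] assms(2) card_field_mod_3 by simp
qed

lemma zero_in_radical: "0 \<in> radical b"
proof -
  obtain u v where uv: "line_basis l u v" using line_basis_exists[OF line] by blast
  show ?thesis using radical_iff[OF uv, of 0 0 b] by simp
qed

text \<open>A nonzero radical vector, taken as first basis vector, brings the form to the shape
  \<open>b\<inverse> S\<^sup>3 + e t\<^sup>3\<close> with \<open>S = s + b B t\<close>, where \<open>e = b \<delta>\<^sup>3\<close> by the discriminant condition.\<close>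

lemma radical_normal_form:
  assumes no_root: "\<And>w. w \<in> l \<Longrightarrow> w \<noteq> 0 \<Longrightarrow> cubic_form w \<noteq> 0"
    and r: "r \<in> radical b" "r \<noteq> 0" and b: "b \<noteq> 0"
  shows "b \<notin> cubes \<and> card (radical b) \<le> 4"
proof -
  have rl: "r \<in> l" using r by (simp add: radical_def)
  obtain v where v: "v \<in> l" "line_basis l r v" using line_basis_extend[OF line rl r(2)] by blast
  let ?A = "cubic_form r" and ?B = "cubic_mix r v" and ?C = "cubic_mix v r" and ?D = "cubic_form v"
  \<comment> \<open>Without roots, the alternative 0 in \<open>radical_value\<close> is
    excluded.\<close>
  have bA: "b * ?A = 1" using radical_value[OF r(1)] no_root[OF rl r(2)] b by auto
  have bC: "b * ?C = (b * ?B)^2"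
    using radical_iff[OF v(2), of 1 0 b] r(1) by simp
  then have C: "?C = b * ?B^2" using b by (simp add: power2_eq_square)
  define e where "e = b^2 * ?B^3 + ?D"
  obtain \<delta> where "?A * ?D + ?B * ?C = \<delta>^3" using discriminant_cube[OF rl v(1)] by blast
  then have "b * \<delta>^3 = b * (?A * ?D + ?B * ?C)" by simp
  also have "\<dots> = (b * ?A) * ?D + b^2 * ?B^3"
    unfolding C by (simp add: algebra_simps power2_eq_square power3_eq_cube)
  finally have "b * \<delta>^3 = (b * ?A) * ?D + b^2 * ?B^3" .
  then have e: "e = b * \<delta>^3" by (simp add: bA e_def add.commute)
  have form: "cubic_form ((X + b * ?B) *s r + 1 *s v) = ?A * X^3 + e" for X
  proof -
    have "cubic_form ((X + b * ?B) *s r + 1 *s v) = ?A * X^3 + (b * ?A) * ?B * X^2 + ?B * X^2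
        + (b * ?A) * b * ?B^2 * X + b * ?B^2 * X + (b * ?A) * b^2 * ?B^3 + ?D"
      unfolding cubic_form_comb C by (simp add: ring_char2)
    also have "\<dots> = ?A * X^3 + e" unfolding bA e_def by (simp add: ring_char2)
    finally show ?thesis .
  qed
  have ne: "x *s r + 1 *s v \<noteq> 0" for x
  proof
    assume "x *s r + 1 *s v = 0"
    moreover have "inj (\<lambda>(s, t). s *s r + t *s v)" using v(2) by (simp add: line_basis_def bij_betw_def)
    ultimately show False using injD[of "\<lambda>(s, t). s *s r + t *s v" "(x, 1)" "(0, 0)"] by simp
  qed
  have form_ne: "?A * X^3 + e \<noteq> 0" for X
    using no_root[OF line_basis_mem(1)[OF v(2)] ne, of "X + b * ?B"] by (simp only: form) simp
  have noncube: "b \<notin> cubes"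
  proof
    assume "b \<in> cubes"
    then obtain \<beta> where \<beta>: "b = \<beta>^3" by (auto simp: cubes_iff)
    \<comment> \<open>For \<open>b = \<beta>^3\<close>, the point
      \<open>X = \<beta>^2 * \<delta>\<close> would be a root of
      \<open>?A * X^3 + e\<close>.\<close>
    have "?A * (\<beta>^2 * \<delta>)^3 = (b * ?A) * b * \<delta>^3"
      unfolding \<beta> by (simp add: power_mult_distrib algebra_simps flip: power_mult power_add)
    then have "?A * (\<beta>^2 * \<delta>)^3 + e = 0" unfolding bA e by (simp add: add_self)
    then show False using form_ne by blast
  qed
  \<comment> \<open>The radical consists of multiples of \<open>r\<close> by roots of
    \<open>x = x^4\<close>; the factors 1 fit the shape of \<open>cubic_radical\<close>.\<close>
  have "radical b \<subseteq> (\<lambda>x. x *s r) ` {x. 1 * x = (1 * x^2)^2}"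
  proof
    fix w assume w: "w \<in> radical b"
    then obtain x y where xy: "w = x *s r + y *s v"
      using line_basis_cases[OF v(2)] by (auto simp: radical_def)
    have "b * (?A * x + ?B * y) = (b * (?A * x^2 + ?C * y^2))^2"
      and "b * (?C * x + ?D * y) = (b * (?B * x^2 + ?D * y^2))^2"
      using w unfolding xy radical_iff[OF v(2)] by auto
    then have "(b * ?A) * x + b * ?B * y = ((b * ?A) * x^2 + (b * ?C) * y^2)^2"
      and e2: "(b * ?C) * x + b * ?D * y = (b * ?B * x^2 + b * ?D * y^2)^2"
      by (simp_all add: algebra_simps)
    then have e1: "x + b * ?B * y = (x^2 + (b * ?B)^2 * y^2)^2" by (simp add: bA bC)
    \<comment> \<open>Adding \<open>(b * ?B)^2\<close> times the first radical equation to the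
      second eliminates \<open>x\<close>.\<close>
    have "b * e * y + (b * e)^2 * y^4 = ((b * ?C) * x + b * ?D * y) + (b * ?B * x^2 + b * ?D * y^2)^2
        + (b * ?B)^2 * (x + b * ?B * y + (x^2 + (b * ?B)^2 * y^2)^2)"
      unfolding bC e_def by (simp add: ring_char2)
    also have "\<dots> = 0" unfolding e2 e1[symmetric] by (simp add: add_self)
    finally have "b * e * y * (1 + b * e * y^3) = 0"
      by (simp add: power2_eq_square power3_eq_cube power4_eq_xxxx algebra_simps)
    moreover have "e \<noteq> 0" using form_ne[of 0] by simp
    ultimately have "y = 0 \<or> b * e * y^3 = 1" using b add_eq_0[of 1 "b * e * y^3"] by simp
    moreover have "b * e * y^3 \<noteq> 1"
    proof
      assume "b * e * y^3 = 1"
      then have "b = b * (b * e * y^3)" by simp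
      also have "\<dots> = (b * \<delta> * y)^3" unfolding e by (simp add: power3_eq_cube ac_simps)
      finally show False using noncube b by (auto simp: cubes_iff)
    qed
    ultimately have "y = 0" by blast
    then show "w \<in> (\<lambda>x. x *s r) ` {x. 1 * x = (1 * x^2)^2}" using e1 xy by auto
  qed
  then have "card (radical b) \<le> card {x::'a. 1 * x = (1 * x^2)^2}"
    by (rule surj_card_le[rotated]) simp
  also have "\<dots> \<le> 4" by (subst cubic_radical) auto
  finally show ?thesis using noncube by simp
qed

text \<open>Radicals for noncubes \<open>b\<close> are only bounded, giving
  \<open>line_sum b \<ge> -2 * q\<close>, while cubes give exactly \<open>q\<close>. The total over
  \<open>b \<noteq> 0\<close>, known from counting zeros of the form, equals the total of these
  lower bounds, so each bound is attained.\<close>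

lemma card_value_no_root:
  assumes no_root: "\<And>w. w \<in> l \<Longrightarrow> w \<noteq> 0 \<Longrightarrow> cubic_form w \<noteq> 0" and c: "c \<noteq> 0"
  shows "int (card {w \<in> l. cubic_form w = c}) = int CARD('a) + 1 + cubic_sum c"
proof -
  let ?q = "int CARD('a)"
  have q: "?q > 0" by simp
  have trivial: "line_sum b = ?q" if "radical b = {0}" for b
    using line_sum_of_card_radical[of b 1] that by simp
  have nontrivial: "\<exists>r\<in>radical b. r \<noteq> 0" if "radical b \<noteq> {0}" for b
    using that zero_in_radical by blast
  have cube: "line_sum b = ?q" if "b \<in> cubes" for b
    using trivial[of b] nontrivial[of b] radical_normal_form[OF no_root, of _ b] that cubes_iff by blast
  have lower: "line_sum b \<ge> -2 * ?q" if "b \<noteq> 0" for b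
  proof (cases "radical b = {0}")
    case True
    then show ?thesis using trivial q by simp
  next
    case False
    then have "card (radical b) \<le> 4"
      using nontrivial[of b] radical_normal_form[OF no_root, of _ b] that by blast
    then have "(line_sum b)^2 \<le> ?q^2 * 4"
      unfolding line_sum_square of_nat_power by (intro mult_left_mono) auto
    then have "(line_sum b)^2 \<le> (2 * ?q)^2" by (simp add: power_mult_distrib)
    then have "\<bar>line_sum b\<bar> \<le> 2 * ?q" using q unfolding abs_le_square_iff[symmetric] by simp
    then show ?thesis by linarith
  qed
  define h where "h b = (if b \<in> cubes then ?q else -2 * ?q)" for b :: 'a
  \<comment> \<open>Fourier inversion at \<open>c = 0\<close> now yields the total of all
    sums.\<close>
  have zero: "{w \<in> l. cubic_form w = 0} = {0}"
    using no_root line by (auto simp: pg_lines_def vec.subspace_0 cubic_mix_def)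
  have "line_sum 0 * psi (0 * 0) + (\<Sum>b\<in>UNIV - {0}. line_sum b * psi (0 * b)) = ?q"
    using sum_line_sum_psi[of 0] unfolding zero by (subst sum.remove[symmetric]) auto
  then have total: "(\<Sum>b\<in>UNIV - {0}. line_sum b) = ?q - ?q^2"
    by (simp add: line_sum_0 psi_0)
  have "(\<Sum>b\<in>UNIV - {0}. h b) = (\<Sum>b\<in>UNIV - {0}. -2 * ?q + (if b \<in> cubes then 3 * ?q else 0))"
    by (intro sum.cong) (auto simp: h_def)
  also have "\<dots> = -2 * ?q * (?q - 1) + 3 * ?q * int (card cubes)"
  proof -
    have "(UNIV - {0}) \<inter> {b. b \<in> cubes} = cubes" by (auto simp: cubes_iff)
    then show ?thesis
      by (simp add: sum.distrib sum_subtractf sum.If_cases card_Diff_singleton of_nat_diff)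
  qed
  also have "3 * ?q * int (card cubes) = ?q * (?q - 1)"
  proof -
    have "3 * int (card cubes) = ?q - 1" using card_cubes q by linarith
    then show ?thesis by simp
  qed
  finally have "(\<Sum>b\<in>UNIV - {0}. h b) = (\<Sum>b\<in>UNIV - {0}. line_sum b)"
    unfolding total by (simp add: algebra_simps power2_eq_square)
  then have "h b = line_sum b" if "b \<noteq> 0" for b
    using cube lower that by (intro sum_mono_inv[of h "UNIV - {0}" line_sum]) (auto simp: h_def)
  then have "3 * ?q * int (card {w \<in> l. cubic_form w = c}) =
    3 * int (CARD('a)^2) - 3 * (-2 * ?q) + (?q - (-2 * ?q)) * (cubic_sum c - 1)"
    using c by (intro card_value) (auto simp: h_def)
  also have "\<dots> = 3 * ?q * (?q + 1 + cubic_sum c)" by (simp add: power2_eq_square algebra_simps)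
  finally show ?thesis using q by simp
qed

text \<open>With roots as basis vectors the two radical equations decouple, one in \<open>x\<close>
  and one in \<open>y\<close>. Each has 4 solutions or 1 according to whether \<open>b\<close> is a
  cube, so the radical has size 16 or 1.\<close>

lemma card_value_three_roots:
  assumes uv: "line_basis l u v" and roots: "cubic_form u = 0" "cubic_form v = 0"
    and mixed: "cubic_mix u v \<noteq> 0" "cubic_mix v u \<noteq> 0" and c: "c \<noteq> 0"
  shows "int (card {w \<in> l. cubic_form w = c}) = int CARD('a) - 2 + cubic_sum c"
proof -
  let ?q = "int CARD('a)"
  have q: "?q > 0" by simp
  obtain \<delta> where \<delta>: "cubic_mix u v * cubic_mix v u = \<delta>^3"
    using discriminant_cube[of u v] line_basis_mem[OF uv] roots by auto
  have card1: "card {y. b * B * y = (b * C * y^2)^2} = (if b \<in> cubes then 4 else 1)"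
    if "b \<noteq> 0" "B \<noteq> 0" "C \<noteq> 0" "B * C = \<delta>^3" for b B C
  proof -
    have \<delta>0: "\<delta> \<noteq> 0" using that by auto
    \<comment> \<open>This is where the discriminant enters: \<open>C^2 / B = C^3 / (B * C)\<close>
      is a cube, so dividing by \<open>B\<close> keeps the cube class of \<open>b\<close>.\<close>
    have k: "b * C^2 / B = b * (C / \<delta>)^3"
      using that \<delta>0 by (simp add: power_divide flip: that(4)) (simp add: field_simps power2_eq_square power3_eq_cube)
    have "{y. b * B * y = (b * C * y^2)^2} = {y. b * C^2 / B * y = (b * C^2 / B * y^2)^2}"
      using that by (intro Collect_cong) (simp add: field_simps power2_eq_square)
    moreover have "b * (C / \<delta>)^3 \<in> cubes \<longleftrightarrow> b \<in> cubes"
    proof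
      assume "b * (C / \<delta>)^3 \<in> cubes"
      then obtain z where "b * (C / \<delta>)^3 = z^3" by (auto simp: cubes_iff)
      then have "b = (z * \<delta> / C)^3" using that \<delta>0 by (simp add: field_simps)
      then show "b \<in> cubes" using that by (auto simp: cubes_iff)
    next
      assume "b \<in> cubes"
      then obtain z where "b = z^3" by (auto simp: cubes_iff)
      then have "b * (C / \<delta>)^3 = (z * (C / \<delta>))^3" by (simp only: power_mult_distrib)
      then show "b * (C / \<delta>)^3 \<in> cubes" using that \<delta>0 unfolding cubes_iff by auto
    qed
    ultimately show ?thesis using cubic_radical[of "b * C^2 / B"] that k \<delta>0 by simp
  qed
  have card_rad: "card (radical b) = (if b \<in> cubes then 4 else 1) * (if b \<in> cubes then 4 else 1)"
    if b: "b \<noteq> 0" for b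
  proof -
    let ?X = "{x. b * cubic_mix v u * x = (b * cubic_mix u v * x^2)^2}"
    let ?Y = "{y. b * cubic_mix u v * y = (b * cubic_mix v u * y^2)^2}"
    have iff: "x *s u + y *s v \<in> radical b \<longleftrightarrow> x \<in> ?X \<and> y \<in> ?Y" for x y
      unfolding radical_iff[OF uv] roots by (auto simp: ac_simps)
    have "radical b = (\<lambda>(x, y). x *s u + y *s v) ` (?X \<times> ?Y)"
    proof
      show "radical b \<subseteq> (\<lambda>(x, y). x *s u + y *s v) ` (?X \<times> ?Y)"
      proof
        fix w assume w: "w \<in> radical b"
        then obtain x y where "w = x *s u + y *s v"
          using line_basis_cases[OF uv] by (auto simp: radical_def)
        then show "w \<in> (\<lambda>(x, y). x *s u + y *s v) ` (?X \<times> ?Y)"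
          using w iff[of x y] by (intro image_eqI[of _ _ "(x, y)"]) auto
      qed
    qed (use iff in auto)
    moreover have "inj_on (\<lambda>(x, y). x *s u + y *s v) (?X \<times> ?Y)"
      using uv by (auto simp: line_basis_def bij_betw_def intro: inj_on_subset)
    ultimately have "card (radical b) = card (?X \<times> ?Y)" by (simp only: card_image)
    then show ?thesis
      using card1[OF b mixed \<delta>] card1[OF b mixed(2,1)] \<delta> by (simp add: card_cartesian_product mult.commute)
  qed
  have sums: "line_sum b = (if b \<in> cubes then 4 * ?q else ?q)" if "b \<noteq> 0" for b
    using card_rad[OF that] line_sum_of_card_radical[of b 4] line_sum_of_card_radical[of b 1] by auto
  have "3 * ?q * int (card {w \<in> l. cubic_form w = c}) =
    3 * int (CARD('a)^2) - 3 * ?q + (4 * ?q - ?q) * (cubic_sum c - 1)"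
    using sums c by (rule card_value)
  also have "\<dots> = 3 * ?q * (?q - 2 + cubic_sum c)" by (simp add: power2_eq_square algebra_simps)
  finally show ?thesis using q by simp
qed

end

section \<open>Points of the line in the orbits\<close>

lemma pg_point_in_points: "w \<noteq> 0 \<Longrightarrow> pg_point w \<in> pg_points"
proof -
  assume "w \<noteq> 0"
  then have "vec.dim {w} = 1" by (intro vec.dim_eq_card_independent[THEN trans]) auto
  then show ?thesis by (simp add: pg_point_def pg_points_def vec.subspace_span vec.dim_span)
qed

lemma pg_point_eq:
  assumes P: "P \<in> pg_points" and w: "w \<in> P" "w \<noteq> 0"
  shows "P = pg_point w"
proof -
  have sub: "vec.subspace P" and dim: "vec.dim P = 1" using P by (auto simp: pg_points_def)
  have "P \<subseteq> vec.span {w}"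
    using w by (intro vec.card_ge_dim_independent) (auto simp: dim)
  moreover have "vec.span {w} \<subseteq> P" using sub w by (intro vec.span_minimal) auto
  ultimately show ?thesis by (simp add: pg_point_def)
qed

lemma pg_points_nonzero:
  assumes "P \<in> pg_points"
  obtains w where "w \<in> P" "w \<noteq> 0"
proof -
  have "vec.dim P = 1" using assms by (simp add: pg_points_def)
  then have "\<not> P \<subseteq> {0}" using vec.dim_eq_0[of P] by linarith
  then show ?thesis using that by blast
qed

lemma pg_point_self: "w \<in> pg_point w"
  by (simp add: pg_point_def vec.span_base)

lemma pg_point_iff: "v \<in> pg_point w \<longleftrightarrow> (\<exists>k. v = k *s w)"
  by (auto simp: pg_point_def vec.span_singleton)

lemma pg_point_on_line:
  assumes "l \<in> pg_lines" "w \<in> l" "w \<noteq> 0"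
  shows "pg_point w \<in> points_on l"
  using assms pg_point_in_points[OF assms(3)]
  by (auto simp: points_on_def pg_lines_def pg_point_iff vec.subspace_scale)

lemma projectivity_pg_point:
  fixes A :: "'a::field ^ 6 ^ 6"
  shows "projectivity A (pg_point v) = pg_point (A *v v)"
proof -
  have "pg_point v = range (\<lambda>k. k *s v)" for v :: "'a ^ 6"
    by (simp add: pg_point_def vec.span_singleton)
  then show ?thesis by (simp add: projectivity_def image_image vector_scalar_commute)
qed

lemma exhaust_6:
  fixes x :: 6
  shows "x = 1 \<or> x = 2 \<or> x = 3 \<or> x = 4 \<or> x = 5 \<or> x = 6"
proof (induct x)
  case (of_int z)
  then have "0 \<le> z" and "z < 6" by simp_all
  then have "z = 0 \<or> z = 1 \<or> z = 2 \<or> z = 3 \<or> z = 4 \<or> z = 5" by arith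
  then show ?case by auto
qed

lemma vec_eq_6_iff:
  fixes x y :: "'a ^ 6"
  shows "x = y \<longleftrightarrow> x $ 1 = y $ 1 \<and> x $ 2 = y $ 2 \<and> x $ 3 = y $ 3 \<and> x $ 4 = y $ 4 \<and> x $ 5 = y $ 5 \<and> x $ 6 = y $ 6"
  unfolding vec_eq_iff by (metis exhaust_6)

lemma vector_6:
  "(vector [a, b, c, d, e, f] :: 'a::zero ^ 6) $ 1 = a"
  "(vector [a, b, c, d, e, f] :: 'a ^ 6) $ 2 = b"
  "(vector [a, b, c, d, e, f] :: 'a ^ 6) $ 3 = c"
  "(vector [a, b, c, d, e, f] :: 'a ^ 6) $ 4 = d"
  "(vector [a, b, c, d, e, f] :: 'a ^ 6) $ 5 = e"
  "(vector [a, b, c, d, e, f] :: 'a ^ 6) $ 6 = f"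
  by (simp_all add: vector_def)

text \<open>Only columns 1 and 5 of the matrix contribute.\<close>

lemma M1_mult_R:
  "M1 a b c d *v (axis 1 1 + \<rho> *s axis 5 1) =
    vector [a^4, b^2 * \<rho>, a^2 * c^2 + b * d * \<rho>, a^2 * c^2 + b * d * \<rho>, d^2 * \<rho>, c^4]"
proof -
  have "(M1 a b c d *v (axis 1 1 + \<rho> *s axis 5 1)) $ i = M1 a b c d $ i $ 1 + \<rho> * M1 a b c d $ i $ 5" for i
    by (simp add: matrix_vector_right_distrib vector_scalar_commute)
      (simp add: matrix_vector_mult_def axis_def if_distrib[of "(*) x" for x] cong: if_cong)
  then show ?thesis
    by (simp add: vec_eq_6_iff M1_def vector_6 mult.commute)
qed

context isotropic_line
begin

text \<open>Orbit vectors have form value \<open>\<rho>^2 * (a * d + b * c)^4\<close>. Conversely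
  \<open>a, b, c, d\<close> are read off coordinates 1, 2, 6, 5 by extracting roots, the quadric
  fixes coordinates 3 and 4, and the form value forces \<open>a * d + b * c = 1\<close>.\<close>

lemma Z_set_iff:
  assumes \<omega>: "\<omega> \<noteq> 0" and P: "P \<in> points_on l"
  shows "P \<in> Z_set \<omega> i \<longleftrightarrow> (\<exists>w\<in>P. cubic_form w = (\<omega> ^ (i - 1))^2)"
proof -
  define \<rho> where "\<rho> = \<omega> ^ (i - 1)"
  have \<rho>0: "\<rho> \<noteq> 0" using \<omega> by (simp add: \<rho>_def)
  define R where "R a b c d = (vector [a^4, b^2 * \<rho>, a^2 * c^2 + b * d * \<rho>, a^2 * c^2 + b * d * \<rho>,
    d^2 * \<rho>, c^4] :: 'a ^ 6)" for a b c d
  have Z: "P \<in> Z_set \<omega> i \<longleftrightarrow> (\<exists>a b c d. a * d + b * c = 1 \<and> P = pg_point (R a b c d))"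
  proof -
    have "P \<in> Z_set \<omega> i \<longleftrightarrow> (\<exists>a b c d. a * d + b * c = 1 \<and>
        P = projectivity (M1 a b c d) (pg_point (axis 1 1 + \<rho> *s axis 5 1)))"
      unfolding Z_set_def G1_orbit_def G1_def R_point_def \<rho>_def[symmetric] by blast
    then show ?thesis by (simp only: projectivity_pg_point M1_mult_R R_def)
  qed
  have R_form: "cubic_form (R a b c d) = \<rho>^2 * (a * d + b * c)^4" for a b c d
    unfolding cubic_mix_def R_def vector_6 by (simp add: ring_char2)
  have "P \<in> Z_set \<omega> i" if w: "w \<in> P" "cubic_form w = \<rho>^2" for w
  proof -
    have wl: "w \<in> l" using P w by (auto simp: points_on_def)
    have eq34: "w $ 3 = w $ 4" using hyperplane[OF wl] by (simp add: add_eq_0)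
    have quad: "(w $ 3)^2 = w $ 1 * w $ 6 + w $ 2 * w $ 5"
      using quadric[OF wl] eq34 by (simp add: add_eq_0 power2_eq_square)
    have root: "\<exists>y. x = y^2" for x :: 'a using bij_square by (metis bij_pointE)
    have root4: "\<exists>y. x = y^4" for x :: 'a
    proof -
      obtain y z where "x = y^2" "y = z^2" using root by metis
      then have "x = z^4" by (simp flip: power_mult)
      then show ?thesis ..
    qed
    obtain a where a: "w $ 1 = a^4" using root4 by blast
    obtain c where c: "w $ 6 = c^4" using root4 by blast
    obtain b where b: "w $ 2 / \<rho> = b^2" using root by blast
    obtain d where d: "w $ 5 / \<rho> = d^2" using root by blast
    have b': "w $ 2 = b^2 * \<rho>" and d': "w $ 5 = d^2 * \<rho>"
      using b d \<rho>0 by (auto simp: field_simps)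
    have "(a^2 * c^2 + b * d * \<rho>)^2 = (w $ 3)^2"
      unfolding quad a c b' d' by (simp add: ring_char2)
    then have w3: "w $ 3 = a^2 * c^2 + b * d * \<rho>" by (simp add: square_eq)
    have wR: "w = R a b c d"
      unfolding vec_eq_6_iff R_def vector_6 using a c b' d' w3 eq34 by simp
    have "\<rho>^2 * (a * d + b * c)^4 = \<rho>^2" using w(2) unfolding wR R_form .
    then have "((a * d + b * c)^2)^2 = (1^2)^2" using \<rho>0 by (simp flip: power_mult)
    then have "a * d + b * c = 1" unfolding square_eq .
    moreover have "w \<noteq> 0" using w \<rho>0 by (auto simp: cubic_mix_def)
    then have "P = pg_point (R a b c d)"
      using pg_point_eq[of P w] P w wR by (simp add: points_on_def)
    ultimately show ?thesis unfolding Z by blast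
  qed
  moreover have "\<exists>w\<in>P. cubic_form w = \<rho>^2" if "P \<in> Z_set \<omega> i"
    using that unfolding Z by (metis R_form pg_point_self power_one mult_1_right)
  ultimately show ?thesis unfolding \<rho>_def by blast
qed

text \<open>By cubic homogeneity, the vectors with a prescribed nonzero value on one point differ by
  the three cube roots of unity.\<close>

lemma card_Z_set:
  assumes \<omega>: "\<omega> \<noteq> 0"
  shows "3 * card (points_on l \<inter> Z_set \<omega> i) = card {w \<in> l. cubic_form w = (\<omega> ^ (i - 1))^2}"
proof -
  define c where "c = (\<omega> ^ (i - 1))^2"
  have c0: "c \<noteq> 0" using \<omega> by (simp add: c_def)
  have nz: "w \<noteq> 0" if "cubic_form w = c" for w using that c0 by (auto simp: cubic_mix_def)
  have "points_on l \<inter> Z_set \<omega> i = pg_point ` {w \<in> l. cubic_form w = c}" (is "?Z = ?I")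
  proof
    show "?Z \<subseteq> ?I"
    proof
      fix P assume P: "P \<in> ?Z"
      then obtain w where w: "w \<in> P" "cubic_form w = c"
        using Z_set_iff[OF \<omega>] by (auto simp: c_def)
      then have "P = pg_point w" using P nz pg_point_eq by (auto simp: points_on_def)
      then show "P \<in> ?I" using w P by (auto simp: points_on_def)
    qed
    show "?I \<subseteq> ?Z"
    proof clarify
      fix w assume w: "w \<in> l" "c = cubic_form w"
      then have "pg_point w \<in> points_on l" using nz pg_point_on_line[OF line] by simp
      then show "pg_point w \<in> ?Z"
        using Z_set_iff[OF \<omega>] w pg_point_self c_def by (metis IntI)
    qed
  qed
  moreover have "card {w \<in> l. cubic_form w = c} = 3 * card (pg_point ` {w \<in> l. cubic_form w = c})"
  proof (rule card_eq_mult_card_image)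
    fix w assume "w \<in> {w \<in> l. cubic_form w = c}"
    then have w: "w \<in> l" "cubic_form w = c" by auto
    have "{v \<in> {w \<in> l. cubic_form w = c}. pg_point v = pg_point w} = (\<lambda>k. k *s w) ` {k. k^3 = 1^3}"
    proof (intro set_eqI iffI)
      fix v assume "v \<in> {v \<in> {w \<in> l. cubic_form w = c}. pg_point v = pg_point w}"
      then have v: "v \<in> l" "cubic_form v = c" "pg_point v = pg_point w" by auto
      then obtain k where k: "v = k *s w" using pg_point_self[of v] by (auto simp: pg_point_iff)
      have "k^3 * c = c" using v(2) w(2) unfolding k cubic_form_scale by simp
      then show "v \<in> (\<lambda>k. k *s w) ` {k. k^3 = 1^3}" using c0 k by auto
    next
      fix v assume "v \<in> (\<lambda>k. k *s w) ` {k. k^3 = 1^3}"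
      then obtain k where k: "v = k *s w" "k^3 = 1" by auto
      have vl: "v \<in> l" using w line k by (simp add: pg_lines_def vec.subspace_scale)
      have vc: "cubic_form v = c" unfolding k(1) cubic_form_scale using k w by simp
      have "pg_point w = pg_point v"
        using pg_point_eq[OF pg_point_in_points[OF nz[OF w(2)]] _ nz[OF vc]] k(1) by (auto simp: pg_point_iff)
      then show "v \<in> {v \<in> {w \<in> l. cubic_form w = c}. pg_point v = pg_point w}" using vl vc by auto
    qed
    moreover have "inj_on (\<lambda>k. k *s w) {k. k^3 = 1^3}"
      using nz[OF w(2)] by (auto simp: inj_on_def)
    ultimately show "card {v \<in> {w \<in> l. cubic_form w = c}. pg_point v = pg_point w} = 3"
      using card_cube_roots[of 1] by (simp add: card_image)
  qed simp
  ultimately show ?thesis by (simp add: c_def)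
qed

section \<open>Intersection with \<open>Y\<close> and roots of the form\<close>

lemma Y_set_iff:
  assumes P: "P \<in> points_on l"
  shows "P \<in> Y_set \<longleftrightarrow> (\<forall>w\<in>P. cubic_form w = 0)"
  using P hyperplane unfolding Y_set_def Pi_hyperplane_def zero_locus_def points_on_def cubic_mix_def
  by auto

lemma pg_point_Y_set_iff:
  assumes "w \<in> l" "w \<noteq> 0"
  shows "pg_point w \<in> Y_set \<longleftrightarrow> cubic_form w = 0"
  unfolding Y_set_iff[OF pg_point_on_line[OF line assms]]
  using pg_point_self[of w] by (auto simp: pg_point_iff cubic_form_scale)

lemma card_value_0_points:
  assumes "points_on l \<inter> Y_set = {}" "c \<noteq> 0"
  shows "int (card {w \<in> l. cubic_form w = c}) = int CARD('a) + 1 + cubic_sum c"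
proof (rule card_value_no_root[OF _ assms(2)])
  show "cubic_form w \<noteq> 0" if "w \<in> l" "w \<noteq> 0" for w
    using assms(1) pg_point_Y_set_iff[OF that] pg_point_on_line[OF line that] by auto
qed

text \<open>Two of the points serve as basis. The third root \<open>s *s u + t *s v\<close> has
  \<open>s, t \<noteq> 0\<close>, which makes the mixed coefficients both zero or both
  nonzero.\<close>

lemma card_value_3_points:
  assumes card3: "card (points_on l \<inter> Y_set) = 3" and q: "CARD('a) > 3" and c: "c \<noteq> 0"
  shows "int (card {w \<in> l. cubic_form w = c}) = int CARD('a) - 2 + cubic_sum c"
proof -
  obtain P1 P2 P3 where P: "points_on l \<inter> Y_set = {P1, P2, P3}" "P1 \<noteq> P2" "P1 \<noteq> P3" "P2 \<noteq> P3"
    using card3 by (auto simp: card_3_iff)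
  have vec: "\<exists>w\<in>l. w \<noteq> 0 \<and> P = pg_point w \<and> cubic_form w = 0" if "P \<in> points_on l \<inter> Y_set" for P
  proof -
    have Pp: "P \<in> pg_points" "P \<subseteq> l" using that by (auto simp: points_on_def)
    obtain w where "w \<in> P" "w \<noteq> 0" using pg_points_nonzero[OF Pp(1)] .
    then show ?thesis using that Pp pg_point_eq[OF Pp(1), of w] Y_set_iff[of P] by auto
  qed
  obtain u where u: "u \<in> l" "u \<noteq> 0" "P1 = pg_point u" "cubic_form u = 0"
    using vec[of P1] P(1) by auto
  obtain v where v: "v \<in> l" "v \<noteq> 0" "P2 = pg_point v" "cubic_form v = 0"
    using vec[of P2] P(1) by auto
  obtain w where w: "w \<in> l" "w \<noteq> 0" "P3 = pg_point w" "cubic_form w = 0"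
    using vec[of P3] P(1) by auto
  have not_mem: "y \<notin> pg_point x" if "x \<noteq> 0" "y \<noteq> 0" "pg_point x \<noteq> pg_point y" for x y :: "'a ^ 6"
    using pg_point_eq[OF pg_point_in_points[OF that(1)] _ that(2)] that(3) by auto
  have uv: "line_basis l u v"
    using not_mem[of u v] P u v by (intro line_basisI[OF line]) (auto simp: pg_point_def)
  obtain s t where st: "w = s *s u + t *s v" using line_basis_cases[OF uv w(1)] .
  have s0: "s \<noteq> 0"
  proof
    assume "s = 0"
    then have "w \<in> pg_point v" using st by (auto simp: pg_point_iff)
    then show False using not_mem[of v w] P v w by auto
  qed
  have t0: "t \<noteq> 0"
  proof
    assume "t = 0"
    then have "w \<in> pg_point u" using st by (auto simp: pg_point_iff)
    then show False using not_mem[of u w] P u w by auto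
  qed
  have "s * t * (cubic_mix u v * s + cubic_mix v u * t) = 0"
    using w(4) u(4) v(4) unfolding st cubic_form_comb by (simp add: algebra_simps power2_eq_square)
  then have lin: "cubic_mix u v * s + cubic_mix v u * t = 0" using s0 t0 by simp
  have not_both: "\<not> (cubic_mix u v = 0 \<and> cubic_mix v u = 0)"
  proof
    assume zero: "cubic_mix u v = 0 \<and> cubic_mix v u = 0"
    have mem: "1 *s u + a *s v \<in> l" for a using line_basis_mem(1)[OF uv] .
    have inj2: "inj (\<lambda>(s, t). s *s u + t *s v)" using uv by (simp add: line_basis_def bij_betw_def)
    have nz: "1 *s u + a *s v \<noteq> 0" for a
      using injD[OF inj2, of "(1, a)" "(0, 0)"] by auto
    \<comment> \<open>If both coefficients vanished, these \<open>CARD('a) > 3\<close> distinct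
      points would all lie in \<open>Y\<close>.\<close>
    have "inj (\<lambda>a. pg_point (1 *s u + a *s v))"
    proof (rule injI)
      fix a a' assume "pg_point (1 *s u + a *s v) = pg_point (1 *s u + a' *s v)"
      then obtain k where "1 *s u + a *s v = k *s (1 *s u + a' *s v)"
        using pg_point_self by (metis pg_point_iff)
      then have "1 *s u + a *s v = k *s u + (k * a') *s v" by (simp add: vec.scale_right_distrib)
      then show "a = a'" using injD[OF inj2, of "(1, a)" "(k, k * a')"] by auto
    qed
    moreover have "range (\<lambda>a. pg_point (1 *s u + a *s v)) \<subseteq> points_on l \<inter> Y_set"
      using pg_point_on_line[OF line mem nz] pg_point_Y_set_iff[OF mem nz] u(4) v(4) zero
      unfolding cubic_form_comb by auto
    ultimately have "CARD('a) \<le> card (points_on l \<inter> Y_set)"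
      by (metis card_inj_on_le P(1) finite.emptyI finite.insertI)
    then show False using card3 q by simp
  qed
  have "cubic_mix u v \<noteq> 0" "cubic_mix v u \<noteq> 0" using lin not_both s0 t0 by auto
  then show ?thesis using card_value_three_roots[OF uv] u v c by blast
qed

end

lemma (in char2_cubic_field) isotropic_line_parabolic_quadric_lines:
  assumes l: "l \<in> (parabolic_quadric_lines :: 'a subsp set)"
  shows "isotropic_line \<zeta> m l"
proof
  show line: "l \<in> pg_lines" using l by (simp add: parabolic_quadric_lines_def)
  fix w assume "w \<in> l"
  show "w $ 1 * w $ 6 + w $ 2 * w $ 5 + w $ 3 * w $ 4 = 0" "w $ 3 + w $ 4 = 0"
  proof (atomize (full), cases "w = 0")
    case False
    then have "pg_point w \<in> parabolic_quadric"
      using l pg_point_on_line[OF line \<open>w \<in> l\<close>] by (auto simp: parabolic_quadric_lines_def)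
    then show "w $ 1 * w $ 6 + w $ 2 * w $ 5 + w $ 3 * w $ 4 = 0 \<and> w $ 3 + w $ 4 = 0"
      using pg_point_self[of w]
      by (auto simp: parabolic_quadric_def hyperbolic_quadric_def Pi_hyperplane_def zero_locus_def)
  qed simp
qed

section \<open>Primitive elements, cubes and the cube root of unity\<close>

lemma finite_field_power_card_minus_one:
  fixes x :: "'a::{field,finite}"
  assumes "x \<noteq> 0"
  shows "x ^ (CARD('a) - 1) = 1"
proof -
  have "bij_betw (\<lambda>y. x * y) (UNIV - {0}) (UNIV - {0})"
    using assms by (intro bij_betwI[where g = "\<lambda>y. y / x"]) auto
  then have "(\<Prod>y\<in>UNIV - {0}. x * y) = (\<Prod>y\<in>UNIV - {0::'a}. y)"
    by (rule prod.reindex_bij_betw)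
  then show ?thesis by (simp add: prod.distrib card_Diff_singleton)
qed

lemma primitive_element_nonzero: "primitive_element \<omega> \<Longrightarrow> \<omega> \<noteq> 0"
  using rangeI[of "\<lambda>k::nat. \<omega> ^ k" 1] by (simp add: primitive_element_def)

lemma primitive_element_power_ne_one:
  fixes \<omega> :: "'a::{field,finite}"
  assumes prim: "primitive_element \<omega>" and j: "0 < j" "j < CARD('a) - 1"
  shows "\<omega> ^ j \<noteq> 1"
proof
  assume "\<omega> ^ j = 1"
  then have "\<omega> ^ k = \<omega> ^ (k mod j)" for k
    by (metis mult_div_mod_eq power_add power_mult power_one mult_1)
  then have "UNIV - {0} \<subseteq> (\<lambda>k. \<omega> ^ k) ` {..<j}"
    using prim j(1) unfolding primitive_element_def by (metis image_subset_iff imageI lessThan_iff mod_less_divisor)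
  then have "card (UNIV - {0::'a}) \<le> card ((\<lambda>k. \<omega> ^ k) ` {..<j})" by (intro card_mono) auto
  also have "\<dots> \<le> j" using card_image_le[of "{..<j}" "\<lambda>k. \<omega> ^ k"] by simp
  finally show False using j(2) by (simp add: card_Diff_singleton)
qed

text \<open>If \<open>\<omega>\<close> were a cube, so would be every nonzero element, against
  \<open>card_cubes\<close>. The exponents 2 and 4 are \<open>2 * (i - 1)\<close> for
  \<open>i = 2, 3\<close>.\<close>

lemma (in char2_cubic_field) primitive_element_powers_noncube:
  assumes prim: "primitive_element (\<omega> :: 'a)"
  shows "\<omega>^2 \<notin> cubes" "\<omega>^4 \<notin> cubes"
proof -
  have w0: "\<omega> \<noteq> 0" using prim by (rule primitive_element_nonzero)
  have noncube: "\<omega> \<noteq> y^3" for y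
  proof
    assume y: "\<omega> = y^3"
    have "x \<in> cubes" if "x \<noteq> 0" for x
    proof -
      have "x \<in> range (\<lambda>k. \<omega> ^ k)" using prim that by (simp add: primitive_element_def)
      then obtain k where "x = \<omega> ^ k" by blast
      then have "x = (y ^ k)^3" unfolding y by (simp add: mult.commute flip: power_mult)
      then show ?thesis using that by (auto simp: cubes_iff)
    qed
    then have "cubes = UNIV - {0::'a}" by (auto simp: cubes_def)
    then have "card cubes = card (UNIV - {0::'a})" by (rule arg_cong)
    also have "\<dots> = CARD('a) - 1" by (simp add: card_Diff_singleton)
    finally have "card cubes = CARD('a) - 1" .
    moreover have "card {0, 1::'a} \<le> CARD('a)" by (intro card_mono) auto
    ultimately show False using card_cubes by simp
  qed
  show "\<omega>^2 \<notin> cubes"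
  proof
    assume "\<omega>^2 \<in> cubes"
    then obtain y where "\<omega>^2 = y^3" by (auto simp: cubes_iff)
    then have "\<omega> = (\<omega> / y)^3" using w0 by (auto simp: field_simps power2_eq_square power3_eq_cube)
    then show False using noncube by blast
  qed
  show "\<omega>^4 \<notin> cubes"
  proof
    assume "\<omega>^4 \<in> cubes"
    then obtain y where "\<omega>^4 = y^3" by (auto simp: cubes_iff)
    then have "\<omega> = (y / \<omega>)^3" using w0 by (simp add: field_simps power3_eq_cube power4_eq_xxxx)
    then show False using noncube by blast
  qed
qed

text \<open>Odd powers of 2 are 2 modulo 3, hence \<open>n\<close> is even; the power of
  \<open>\<omega>\<close> with exponent \<open>(CARD('a) - 1) / 3\<close> is a cube root of unity
  other than 1.\<close>

lemma char2_cubic_field_primitive_element: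
  fixes \<omega> :: "'a::{field,finite}"
  assumes card: "CARD('a) = 2 ^ n" and n: "n \<ge> 2" and mod3: "CARD('a) mod 3 = 1"
    and prim: "primitive_element \<omega>"
  shows "even n" "\<exists>\<zeta>. char2_cubic_field (\<zeta> :: 'a) (n div 2)"
proof -
  show n: "even n"
  proof (rule ccontr)
    assume "odd n"
    then obtain k where k: "n = 2 * k + 1" by (elim oddE)
    have "(4::nat) ^ k mod 3 = 1" by (induction k) (auto simp: mod_mult_right_eq, presburger)
    then have "(2 * (4::nat) ^ k) mod 3 = 2" by presburger
    then show False using mod3 card k by (simp add: power_mult)
  qed
  \<comment> \<open>Comparing the sum of all field elements with its translate by 1 gives
    \<open>2 ^ n = 0\<close> in the field.\<close>
  have "bij (\<lambda>x::'a. x + 1)" by (rule bij_plus_right)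
  then have "(\<Sum>x\<in>UNIV. x + 1) = (\<Sum>x\<in>UNIV. x :: 'a)" by (rule sum.reindex_bij_betw)
  then have "of_nat CARD('a) = (0::'a)" by (simp add: sum.distrib)
  then have two: "(2::'a) = 0" by (simp add: card)
  define j where "j = (CARD('a) - 1) div 3"
  have "(2::nat) ^ 2 \<le> 2 ^ n" using \<open>n \<ge> 2\<close> by (intro power_increasing) auto
  then have j: "3 * j = CARD('a) - 1" "0 < j" "j < CARD('a) - 1"
    using mod3 card unfolding j_def by simp_all presburger+
  define \<zeta> where "\<zeta> = \<omega> ^ j"
  have "\<zeta> ^ 3 = 1"
    using finite_field_power_card_minus_one[OF primitive_element_nonzero[OF prim]] j(1)
    by (simp add: \<zeta>_def mult.commute flip: power_mult)
  then have "(\<zeta> - 1) * (\<zeta>^2 + \<zeta> + 1) = 0" by (simp add: algebra_simps power2_eq_square power3_eq_cube)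
  moreover have "\<zeta> \<noteq> 1" unfolding \<zeta>_def by (rule primitive_element_power_ne_one[OF prim j(2,3)])
  ultimately have "\<zeta>^2 + \<zeta> + 1 = 0" by simp
  then have "char2_cubic_field \<zeta> (n div 2)" using two card n by unfold_locales auto
  then show "\<exists>\<zeta>. char2_cubic_field (\<zeta> :: 'a) (n div 2)" ..
qed

theorem proposition4p10:
  fixes \<omega> :: "'a::{field,finite}" and q n :: nat
  assumes "CARD('a) = q" and "q = 2 ^ n" and "n \<ge> 3" and "q mod 3 = 1"
    and "primitive_element \<omega>"
  shows "(\<forall>l \<in> (L_lines 3 :: 'a subsp set).
            card (points_on l \<inter> Y_set) = 3 \<and>
            real (card (points_on l \<inter> Z_set \<omega> 1)) =
              (real q - (-1) ^ (n div 2) * 2 * sqrt (real q) - 2) / 3 \<and>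
            (\<forall>i \<in> {2, 3}. real (card (points_on l \<inter> Z_set \<omega> i)) =
              (real q + (-1) ^ (n div 2) * sqrt (real q) - 2) / 3)) \<and>
         (\<forall>l \<in> (L_lines 0 :: 'a subsp set).
            real (card (points_on l \<inter> Z_set \<omega> 1)) =
              (real q - (-1) ^ (n div 2) * 2 * sqrt (real q) + 1) / 3 \<and>
            (\<forall>i \<in> {2, 3}. real (card (points_on l \<inter> Z_set \<omega> i)) =
              (real q + (-1) ^ (n div 2) * sqrt (real q) + 1) / 3))"
proof -
  define m where "m = n div 2"
  obtain \<zeta> :: 'a where "char2_cubic_field \<zeta> m" and n: "n = 2 * m"
    using char2_cubic_field_primitive_element[of n \<omega>] assms unfolding m_def by auto
  then interpret char2_cubic_field \<zeta> m by simp
  have w0: "\<omega> \<noteq> 0" using assms(5) by (rule primitive_element_nonzero)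
  \<comment> \<open>Here \<open>sqrt q = 2 ^ m\<close>, so the signed root of the statement is a
    power of \<open>-2\<close>.\<close>
  have e: "(-1) ^ m * sqrt (real q) = (-2) ^ m"
    using real_sqrt_unique[of "2 ^ m" "real q"]
    by (simp add: assms(2) n power_mult power2_eq_square flip: power_mult_distrib)
  have sum1: "real_of_int (cubic_sum ((\<omega> ^ (1 - 1))^2)) = - 2 * (-2) ^ m"
  proof -
    have "1 \<in> cubes" unfolding cubes_iff by (auto intro: exI[of _ 1])
    then show ?thesis by (simp add: cubic_sum_eq)
  qed
  have sum23: "real_of_int (cubic_sum ((\<omega> ^ (i - 1))^2)) = (-2) ^ m" if "i \<in> {2, 3}" for i :: nat
  proof -
    have "(\<omega> ^ (i - 1))^2 \<notin> cubes"
      using that primitive_element_powers_noncube[OF assms(5)] by (auto simp flip: power_mult)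
    then show ?thesis using w0 by (simp add: cubic_sum_eq)
  qed
  \<comment> \<open>\<open>d\<close> is the offset in the vector count, \<open>-2\<close> for three
    roots and \<open>1\<close> for none; dividing by 3 passes from vectors to points.\<close>
  have L: "real (card (points_on l \<inter> Z_set \<omega> i)) = (real q + d + cubic_sum ((\<omega> ^ (i - 1))^2)) / 3"
    if "l \<in> L_lines k" "k = 3 \<and> d = -2 \<or> k = 0 \<and> d = 1" for l :: "'a subsp" and i k d
  proof -
    have Q: "l \<in> parabolic_quadric_lines" and fin: "finite (points_on l \<inter> Y_set)"
      and card: "card (points_on l \<inter> Y_set) = k"
      using that(1) by (auto simp: L_lines_def)
    interpret isotropic_line \<zeta> m l by (rule isotropic_line_parabolic_quadric_lines[OF Q])
    have "(2::nat) ^ 3 \<le> 2 ^ n" using assms(3) by (intro power_increasing) auto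
    then have q3: "CARD('a) > 3" using assms(1,2) by simp
    have c0: "(\<omega> ^ (i - 1))^2 \<noteq> 0" using w0 by simp
    have "int (card {w \<in> l. cubic_form w = (\<omega> ^ (i - 1))^2}) = int q + d + cubic_sum ((\<omega> ^ (i - 1))^2)"
      using that(2)
    proof (elim disjE conjE)
      assume "k = 3" "d = -2"
      then show ?thesis using card_value_3_points[OF _ q3 c0] card assms(1) by simp
    next
      assume "k = 0" "d = 1"
      \<comment> \<open>\<open>fin\<close> is what turns cardinality 0 into emptiness.\<close>
      then show ?thesis using card_value_0_points[OF _ c0] card fin assms(1) by simp
    qed
    then have "int (3 * card (points_on l \<inter> Z_set \<omega> i)) = int q + d + cubic_sum ((\<omega> ^ (i - 1))^2)"
      unfolding card_Z_set[OF w0] .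
    then have "real (3 * card (points_on l \<inter> Z_set \<omega> i)) = real q + d + cubic_sum ((\<omega> ^ (i - 1))^2)"
      by linarith
    then show ?thesis by simp
  qed
  have sign: "(-1) ^ (n div 2) * 2 * sqrt (real q) = 2 * (-2) ^ m" "(-1) ^ (n div 2) * sqrt (real q) = (-2) ^ m"
    using e by (simp_all add: m_def)
  show ?thesis
    unfolding sign using L[of _ 3 "-2"] L[of _ 0 1] sum1 sum23 by (simp add: L_lines_def)
qed

end
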